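(* Let $\|\cdot\|$ be an admissible norm on $\mathbb{R}^3$ and let $f:M\to(\mathbb{R}^3,\|\cdot\|)$ be an immersed connected surface all of whose points are umbilic. Then $M$ (identified with $f(M)$) is contained in a plane or in a Minkowski sphere.
   Context: Let $B$ and $\partial B$ be the unit ball and unit sphere of $\|\cdot\|$. The norm is admissible if it is smooth ($\partial B$ is locally the graph of a $C^\infty$ function), strictly convex ($\partial B$ contains no line segment), and $\partial B$ has positive Euclidean Gaussian curvature at every point. A Minkowski sphere of radius $\rho>0$ is a set $\{x:\|x-c\|=\rho\}$. A non-zero vector $v$ is Birkhoff orthogonal to a 2-dimensional subspace $H$ ($v\dashv_B H$) if the plane through $v/\|v\|$ parallel to $H$ supports $B$. For a smooth immersion of a surface, $M$ is identified with its image and $T_pM$ with the plane $df_p(T_pM)\subset\mathbb{R}^3$. A Birkhoff normal vector field is a (locally defined) smooth map $\eta$ into $\partial B$ with $\eta(p)\dashv_B T_pM$; it is unique up to sign. Since $T_{\eta(p)}\partial B$ and $T_pM$ are the same plane, $d\eta_p$ is a linear endomorphism of $T_pM$. The eigenvalues of $d\eta_p$ are the principal curvatures of $M$ at $p$. A point $p$ is umbilic if the two principal curvatures at $p$ are equal, equivalently if $d\eta_p$ is a multiple of the identity of $T_pM$ (independent of the choice of $\pm\eta$). *)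

theory Defs
  imports "HOL-Analysis.Analysis"
begin

section \<open>Smooth maps between Euclidean spaces\<close>

text \<open>On an open set \<open>S\<close>, \<open>Ck_on k f S\<close> says that \<open>f\<close> is of class \<open>C\<^sup>k\<close>: it is
  differentiable and each of its directional derivatives is of class \<open>C\<^sup>k\<^sup>-\<^sup>1\<close>.\<close>

primrec Ck_on ::
  "nat \<Rightarrow> ('a::euclidean_space \<Rightarrow> 'b::euclidean_space) \<Rightarrow> 'a set \<Rightarrow> bool" where
  "Ck_on 0 f S \<longleftrightarrow> continuous_on S f"
| "Ck_on (Suc k) f S \<longleftrightarrow>
     (\<forall>x\<in>S. f differentiable at x) \<and>
     (\<forall>v. Ck_on k (\<lambda>x. frechet_derivative f (at x) v) S)"

definition smooth_on ::
  "'a set \<Rightarrow> ('a::euclidean_space \<Rightarrow> 'b::euclidean_space) \<Rightarrow> bool" where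
  "smooth_on S f \<longleftrightarrow> open S \<and> (\<forall>k. Ck_on k f S)"


section \<open>Euclidean Gaussian curvature of a parametrized surface\<close>

definition pderiv2 :: "2 \<Rightarrow> (real^2 \<Rightarrow> real^3) \<Rightarrow> real^2 \<Rightarrow> real^3" where
  "pderiv2 i X w = frechet_derivative X (at w) (axis i 1)"

definition unit_normal :: "(real^2 \<Rightarrow> real^3) \<Rightarrow> real^2 \<Rightarrow> real^3" where
  "unit_normal X w = sgn (cross3 (pderiv2 1 X w) (pderiv2 2 X w))"

definition fff :: "(real^2 \<Rightarrow> real^3) \<Rightarrow> 2 \<Rightarrow> 2 \<Rightarrow> real^2 \<Rightarrow> real" where
  "fff X i j w = pderiv2 i X w \<bullet> pderiv2 j X w"

definition sff :: "(real^2 \<Rightarrow> real^3) \<Rightarrow> 2 \<Rightarrow> 2 \<Rightarrow> real^2 \<Rightarrow> real" where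
  "sff X i j w = pderiv2 i (pderiv2 j X) w \<bullet> unit_normal X w"

text \<open>With \<open>E, F, G\<close> and \<open>L, M, N\<close> the coefficients of the first and second fundamental
  forms, this is \<open>(L N - M\<^sup>2) / (E G - F\<^sup>2)\<close>.\<close>

definition gauss_curvature :: "(real^2 \<Rightarrow> real^3) \<Rightarrow> real^2 \<Rightarrow> real" where
  "gauss_curvature X w =
     (sff X 1 1 w * sff X 2 2 w - (sff X 1 2 w)\<^sup>2) /
     (fff X 1 1 w * fff X 2 2 w - (fff X 1 2 w)\<^sup>2)"


section \<open>Admissible norms on three-space\<close>

definition is_norm :: "(real^3 \<Rightarrow> real) \<Rightarrow> bool" where
  "is_norm N \<longleftrightarrow>
     (\<forall>x. 0 \<le> N x) \<and> (\<forall>x. N x = 0 \<longleftrightarrow> x = 0) \<and>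
     (\<forall>c x. N (c *\<^sub>R x) = \<bar>c\<bar> * N x) \<and>
     (\<forall>x y. N (x + y) \<le> N x + N y)"

definition unit_ball :: "(real^3 \<Rightarrow> real) \<Rightarrow> (real^3) set" where
  "unit_ball N = {x. N x \<le> 1}"

definition minkowski_sphere :: "(real^3 \<Rightarrow> real) \<Rightarrow> real^3 \<Rightarrow> real \<Rightarrow> (real^3) set" where
  "minkowski_sphere N c \<rho> = {x. N (x - c) = \<rho>}"

definition unit_sphere :: "(real^3 \<Rightarrow> real) \<Rightarrow> (real^3) set" where
  "unit_sphere N = {x. N x = 1}"

text \<open>\<open>graph_chart S W X\<close>: with respect to some orthonormal frame, \<open>X\<close> parametrizes the
  graph of a \<open>C\<^sup>\<infinity>\<close> function on \<open>W\<close>, and this graph is a relatively open piece of \<open>S\<close>.\<close>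

definition graph_chart :: "(real^3) set \<Rightarrow> (real^2) set \<Rightarrow> (real^2 \<Rightarrow> real^3) \<Rightarrow> bool" where
  "graph_chart S W X \<longleftrightarrow>
     (\<exists>e1 e2 e3 h V.
        norm e1 = 1 \<and> norm e2 = 1 \<and> norm e3 = 1 \<and>
        e1 \<bullet> e2 = 0 \<and> e1 \<bullet> e3 = 0 \<and> e2 \<bullet> e3 = 0 \<and>
        smooth_on W (h :: real^2 \<Rightarrow> real) \<and>
        X = (\<lambda>w. (w $ 1) *\<^sub>R e1 + (w $ 2) *\<^sub>R e2 + h w *\<^sub>R e3) \<and>
        open V \<and> S \<inter> V = X ` W)"

definition smooth_norm :: "(real^3 \<Rightarrow> real) \<Rightarrow> bool" where
  "smooth_norm N \<longleftrightarrow>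
     (\<forall>p\<in>unit_sphere N. \<exists>W X. graph_chart (unit_sphere N) W X \<and> p \<in> X ` W)"

definition strictly_convex_norm :: "(real^3 \<Rightarrow> real) \<Rightarrow> bool" where
  "strictly_convex_norm N \<longleftrightarrow> (\<forall>x y. x \<noteq> y \<longrightarrow> \<not> closed_segment x y \<subseteq> unit_sphere N)"

text \<open>Gaussian curvature does not depend on the parametrization, so it is measured in every
  local graph parametrization of the unit sphere; for a smooth norm these cover the sphere.\<close>

definition positively_curved_norm :: "(real^3 \<Rightarrow> real) \<Rightarrow> bool" where
  "positively_curved_norm N \<longleftrightarrow>
     (\<forall>W X. graph_chart (unit_sphere N) W X \<longrightarrow> (\<forall>w\<in>W. 0 < gauss_curvature X w))"

definition admissible_norm :: "(real^3 \<Rightarrow> real) \<Rightarrow> bool" where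
  "admissible_norm N \<longleftrightarrow>
     is_norm N \<and> smooth_norm N \<and> strictly_convex_norm N \<and> positively_curved_norm N"


section \<open>Birkhoff orthogonality\<close>

definition supports :: "(real^3) set \<Rightarrow> (real^3) set \<Rightarrow> bool" where
  "supports P K \<longleftrightarrow>
     (\<exists>a b. a \<noteq> 0 \<and> P = {x. a \<bullet> x = b} \<and> K \<subseteq> {x. a \<bullet> x \<le> b} \<and> P \<inter> K \<noteq> {})"

definition birkhoff_orthogonal ::
  "(real^3 \<Rightarrow> real) \<Rightarrow> real^3 \<Rightarrow> (real^3) set \<Rightarrow> bool" where
  "birkhoff_orthogonal N v H \<longleftrightarrow>
     v \<noteq> 0 \<and> subspace H \<and> dim H = 2 \<and>
     supports ((\<lambda>h. v /\<^sub>R N v + h) ` H) (unit_ball N)"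


section \<open>Smooth surfaces and immersions\<close>

text \<open>A chart is a pair \<open>(U, \<phi>)\<close> of an open set and a homeomorphism of \<open>U\<close> onto an open
  subset of the plane.\<close>

type_synonym 'a chart = "'a set \<times> ('a \<Rightarrow> real^2)"

definition is_chart :: "'a topology \<Rightarrow> 'a chart \<Rightarrow> bool" where
  "is_chart M c \<longleftrightarrow>
     (case c of (U, \<phi>) \<Rightarrow>
        openin M U \<and> open (\<phi> ` U) \<and>
        homeomorphic_map (subtopology M U) (top_of_set (\<phi> ` U)) \<phi>)"

definition in_chart :: "'a chart \<Rightarrow> ('a \<Rightarrow> 'b) \<Rightarrow> real^2 \<Rightarrow> 'b" where
  "in_chart c g = g \<circ> inv_into (fst c) (snd c)"

definition smooth_atlas :: "'a topology \<Rightarrow> 'a chart set \<Rightarrow> bool" where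
  "smooth_atlas M A \<longleftrightarrow>
     (\<forall>c\<in>A. is_chart M c) \<and> topspace M = (\<Union>c\<in>A. fst c) \<and>
     (\<forall>c\<in>A. \<forall>d\<in>A. smooth_on (snd c ` (fst c \<inter> fst d)) (in_chart c (snd d)))"

definition smooth_surface :: "'a topology \<Rightarrow> 'a chart set \<Rightarrow> bool" where
  "smooth_surface M A \<longleftrightarrow>
     Hausdorff_space M \<and> second_countable M \<and> smooth_atlas M A"

definition smooth_map_on :: "'a chart set \<Rightarrow> 'a set \<Rightarrow> ('a \<Rightarrow> real^3) \<Rightarrow> bool" where
  "smooth_map_on A V g \<longleftrightarrow>
     (\<forall>c\<in>A. smooth_on (snd c ` (fst c \<inter> V)) (in_chart c g))"

definition chart_at :: "'a chart set \<Rightarrow> 'a \<Rightarrow> 'a chart" where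
  "chart_at A p = (SOME c. c \<in> A \<and> p \<in> fst c)"

text \<open>The abstract tangent space at \<open>p\<close> is identified with the coordinate plane by means of
  \<open>chart_at A p\<close>. Different charts change \<open>differential A g p\<close> by precomposition with an
  automorphism of the plane that does not depend on \<open>g\<close>; the tangent plane and the map
  \<open>tangent_endo\<close> below are therefore independent of the chart.\<close>

definition differential :: "'a chart set \<Rightarrow> ('a \<Rightarrow> real^3) \<Rightarrow> 'a \<Rightarrow> real^2 \<Rightarrow> real^3" where
  "differential A g p =
     frechet_derivative (in_chart (chart_at A p) g) (at (snd (chart_at A p) p))"

definition immersion :: "'a topology \<Rightarrow> 'a chart set \<Rightarrow> ('a \<Rightarrow> real^3) \<Rightarrow> bool" where
  "immersion M A f \<longleftrightarrow>
     smooth_map_on A (topspace M) f \<and> (\<forall>p\<in>topspace M. inj (differential A f p))"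

definition tangent_plane :: "'a chart set \<Rightarrow> ('a \<Rightarrow> real^3) \<Rightarrow> 'a \<Rightarrow> (real^3) set" where
  "tangent_plane A f p = range (differential A f p)"


section \<open>Birkhoff normals, principal curvatures, umbilic points\<close>

definition birkhoff_normal_field ::
  "(real^3 \<Rightarrow> real) \<Rightarrow> 'a topology \<Rightarrow> 'a chart set \<Rightarrow> ('a \<Rightarrow> real^3) \<Rightarrow>
   'a set \<Rightarrow> ('a \<Rightarrow> real^3) \<Rightarrow> bool" where
  "birkhoff_normal_field N M A f V \<eta> \<longleftrightarrow>
     openin M V \<and> smooth_map_on A V \<eta> \<and> \<eta> ` V \<subseteq> unit_sphere N \<and>
     (\<forall>q\<in>V. birkhoff_orthogonal N (\<eta> q) (tangent_plane A f q))"

text \<open>The differential of \<open>\<eta>\<close> at \<open>p\<close>, as a map defined on \<open>tangent_plane A f p\<close>.\<close>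

definition tangent_endo ::
  "'a chart set \<Rightarrow> ('a \<Rightarrow> real^3) \<Rightarrow> ('a \<Rightarrow> real^3) \<Rightarrow> 'a \<Rightarrow> real^3 \<Rightarrow> real^3" where
  "tangent_endo A f \<eta> p v = differential A \<eta> p (inv (differential A f p) v)"

definition principal_curvatures ::
  "'a chart set \<Rightarrow> ('a \<Rightarrow> real^3) \<Rightarrow> ('a \<Rightarrow> real^3) \<Rightarrow> 'a \<Rightarrow> real set" where
  "principal_curvatures A f \<eta> p =
     {k. \<exists>v\<in>tangent_plane A f p. v \<noteq> 0 \<and> tangent_endo A f \<eta> p v = k *\<^sub>R v}"

text \<open>For an admissible norm \<open>d\<eta>\<^sub>p\<close> is an endomorphism of the tangent plane that is
  diagonalizable over the reals, so its two eigenvalues coincide exactly when the set of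
  eigenvalues is a singleton. A normal field exists near every point and is unique up to
  sign, and replacing \<open>\<eta>\<close> by \<open>-\<eta>\<close> only negates the principal curvatures.\<close>

definition umbilic ::
  "(real^3 \<Rightarrow> real) \<Rightarrow> 'a topology \<Rightarrow> 'a chart set \<Rightarrow> ('a \<Rightarrow> real^3) \<Rightarrow> 'a \<Rightarrow> bool" where
  "umbilic N M A f p \<longleftrightarrow>
     (\<exists>V \<eta>. p \<in> V \<and> birkhoff_normal_field N M A f V \<eta> \<and>
            (\<exists>k. principal_curvatures A f \<eta> p = {k}))"

end

theory Submission
  imports Defs
begin

text \<open>As in Euclidean geometry, the theorem comes down to showing that a Birkhoff normal field
  \<open>\<eta>\<close> of a totally umbilic surface satisfies \<open>\<eta> = k f + c\<close> with a constant number \<open>k\<close> and a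
  constant vector \<open>c\<close>. If \<open>k \<noteq> 0\<close>, then \<open>N (k f + c) = 1\<close> places the surface on the Minkowski sphere
  with centre \<open>- c / k\<close> and radius \<open>1 / |k|\<close>. If \<open>k = 0\<close>, the normal is the constant \<open>c\<close>; as
  the unit sphere is smooth, \<open>c\<close> is Birkhoff orthogonal to one plane only, so all tangent
  planes of the surface are parallel and the surface is planar.

  Umbilicity speaks of eigenvalues only, so one first needs that \<open>d\<eta>\<close> is diagonalizable
  (\<open>umbilic_imp_proportional\<close>). Write the unit sphere near a value of \<open>\<eta>\<close> as the graph of a function
  \<open>h\<close>. Surface and sphere have a common Euclidean normal, and differentiating its
  orthogonality to the surface shows that \<open>d\<eta>\<close> is self-adjoint with respect to the Hessian
  form of \<open>h\<close>. This form is definite because the sphere has positive curvature. A single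
  eigenvalue then gives \<open>d\<eta> = \<kappa> df\<close>, and the symmetry of second derivatives forces \<open>\<kappa>\<close> to be locally
  constant (\<open>proportional_imp_affine\<close>). Integration gives \<open>\<eta> = k f + c\<close> on a coordinate disc.

  For the passage to the whole surface, strict convexity makes the Birkhoff normal unique up to
  sign, so near each point the pair \<open>(k, c)\<close> is determined up to a common sign
  (\<open>affine_normal_at_unique\<close>). The set of the two possible pairs is a locally constant function of the
  point, hence constant by connectedness. Working with this set avoids any choice of
  orientation, so that non-orientable surfaces need no separate argument.\<close>

section \<open>Symmetry of second derivatives\<close>

lemma has_derivative_along_line:
  assumes "(f has_derivative f') (at (c + r *\<^sub>R u))"
  shows "((\<lambda>r. f (c + r *\<^sub>R u)) has_derivative (\<lambda>h. f' (h *\<^sub>R u))) (at r within T)"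
  by (rule has_derivative_compose[where g = f and g' = f' and f = "\<lambda>r. c + r *\<^sub>R u"
        and f' = "\<lambda>h. h *\<^sub>R u", OF _ assms]) (auto intro!: derivative_eq_intros)

text \<open>The left-hand side of the conclusion is unchanged when \<open>u\<close> and \<open>v\<close> are exchanged, while on
  the right \<open>u\<close> is the direction of the first derivative and \<open>v\<close> that of the second. It arises
  from the mean value theorem in direction \<open>u\<close> for the difference of \<open>f\<close> on two parallel edges
  of the parallelogram, and then in direction \<open>v\<close> for the derivative so obtained.\<close>

lemma second_difference_mean_value:
  fixes f :: "'a::real_normed_vector \<Rightarrow> real"
  assumes "s > 0"
    and S: "\<And>a b. a \<in> {0..s} \<Longrightarrow> b \<in> {0..s} \<Longrightarrow> x + a *\<^sub>R u + b *\<^sub>R v \<in> S"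
    and f': "\<And>y. y \<in> S \<Longrightarrow> (f has_derivative f' y) (at y)"
    and f'': "\<And>y. y \<in> S \<Longrightarrow> ((\<lambda>z. f' z u) has_derivative f'' y) (at y)"
  obtains a b where "a \<in> {0..s}" "b \<in> {0..s}"
    "f (x + s *\<^sub>R u + s *\<^sub>R v) - f (x + s *\<^sub>R u) - f (x + s *\<^sub>R v) + f x
      = s\<^sup>2 * f'' (x + a *\<^sub>R u + b *\<^sub>R v) v"
proof -
  define g where "g r = f (x + r *\<^sub>R u + s *\<^sub>R v) - f (x + r *\<^sub>R u)" for r
  have S0: "x + a *\<^sub>R u \<in> S" if "a \<in> {0..s}" for a
    using S[of a 0] that \<open>s > 0\<close> by simp
  have lin': "f' y (r *\<^sub>R w) = r * f' y w" if "y \<in> S" for y w r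
    using linear_cmul[OF has_derivative_linear[OF f'[OF that]]] by simp
  have lin'': "f'' y (r *\<^sub>R w) = r * f'' y w" if "y \<in> S" for y w r
    using linear_cmul[OF has_derivative_linear[OF f''[OF that]]] by simp
  have g': "(g has_derivative (\<lambda>h. f' (x + r *\<^sub>R u + s *\<^sub>R v) (h *\<^sub>R u) - f' (x + r *\<^sub>R u) (h *\<^sub>R u)))
      (at r within {0..s})" if "r \<in> {0..s}" for r
  proof -
    have eq: "x + r *\<^sub>R u + s *\<^sub>R v = x + s *\<^sub>R v + r *\<^sub>R u" for r
      by (simp add: algebra_simps)
    have "x + s *\<^sub>R v + r *\<^sub>R u \<in> S"
      using S[of r s] that \<open>s > 0\<close> by (simp add: eq)
    from has_derivative_diff[OF has_derivative_along_line[OF f'[OF this]] has_derivative_along_line[OF f'[OF S0[OF that]]]]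
    show ?thesis unfolding g_def eq .
  qed
  obtain a where a: "a \<in> {0<..<s}" "g s - g 0
      = f' (x + a *\<^sub>R u + s *\<^sub>R v) (s *\<^sub>R u) - f' (x + a *\<^sub>R u) (s *\<^sub>R u)"
    using mvt_simple[OF \<open>s > 0\<close> g'] by fastforce
  have a': "a \<in> {0..s}" using a by auto
  have h': "((\<lambda>r. f' (x + a *\<^sub>R u + r *\<^sub>R v) u) has_derivative
      (\<lambda>h. f'' (x + a *\<^sub>R u + r *\<^sub>R v) (h *\<^sub>R v))) (at r within {0..s})" if "r \<in> {0..s}" for r
    by (rule has_derivative_along_line[OF f''[OF S[OF a' that]]])
  obtain b where b: "b \<in> {0<..<s}" "f' (x + a *\<^sub>R u + s *\<^sub>R v) u - f' (x + a *\<^sub>R u + 0 *\<^sub>R v) u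
      = f'' (x + a *\<^sub>R u + b *\<^sub>R v) (s *\<^sub>R v)"
    using mvt_simple[OF \<open>s > 0\<close> h'] by fastforce
  have b': "b \<in> {0..s}" using b by auto
  have "f (x + s *\<^sub>R u + s *\<^sub>R v) - f (x + s *\<^sub>R u) - f (x + s *\<^sub>R v) + f x = g s - g 0"
    by (simp add: g_def)
  also have "\<dots> = s * (f' (x + a *\<^sub>R u + s *\<^sub>R v) u - f' (x + a *\<^sub>R u) u)"
    using a a' S S0 \<open>s > 0\<close> by (simp add: lin' right_diff_distrib)
  also have "\<dots> = s * (s * f'' (x + a *\<^sub>R u + b *\<^sub>R v) v)"
    using b(2) lin''[OF S[OF a' b']] by simp
  finally show thesis using that[OF a' b'] by (simp add: power2_eq_square)
qed

text \<open>Over a small parallelogram at \<open>x\<close> one and the same second difference is, up to the factor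
  \<open>s\<^sup>2\<close>, a value of either mixed derivative; both values are close to those at \<open>x\<close> by
  continuity.\<close>

lemma symmetric_second_derivative:
  fixes f :: "'a::real_normed_vector \<Rightarrow> 'b::euclidean_space"
  assumes S: "open S" "x \<in> S"
    and f': "\<And>y. y \<in> S \<Longrightarrow> (f has_derivative f' y) (at y)"
    and f'': "\<And>y w. y \<in> S \<Longrightarrow> ((\<lambda>z. f' z w) has_derivative f'' w y) (at y)"
    and cont: "\<And>w w'. continuous_on S (\<lambda>y. f'' w y w')"
  shows "f'' v x u = f'' u x v"
proof (rule euclidean_eqI)
  fix b :: 'b assume "b \<in> Basis"
  let ?p = "\<lambda>y. f'' v y u \<bullet> b" and ?q = "\<lambda>y. f'' u y v \<bullet> b"
  show "?p x = ?q x"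
  proof (rule ccontr)
    assume ne: "?p x \<noteq> ?q x"
    define e where "e = \<bar>?p x - ?q x\<bar> / 2"
    have "e > 0" using ne by (simp add: e_def)
    have ev: "\<forall>\<^sub>F y in nhds x. y \<in> S" using S by (rule eventually_nhds_in_open)
    have lim: "((\<lambda>y. f'' w y w') \<longlongrightarrow> f'' w x w') (nhds x)" for w w'
    proof -
      have "isCont (\<lambda>y. f'' w y w') x"
        using cont[of w w'] S by (simp add: continuous_on_eq_continuous_at)
      then show ?thesis
        unfolding isCont_def using tendsto_at_iff_tendsto_nhds[of "\<lambda>y. f'' w y w'" x] by blast
    qed
    have "(?p \<longlongrightarrow> ?p x) (nhds x)" "(?q \<longlongrightarrow> ?q x) (nhds x)"
      by (intro tendsto_intros lim)+
    then have "\<forall>\<^sub>F y in nhds x. dist (?p y) (?p x) < e" "\<forall>\<^sub>F y in nhds x. dist (?q y) (?q x) < e"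
      using \<open>e > 0\<close> by (auto dest: tendstoD)
    with ev have "\<forall>\<^sub>F y in nhds x. y \<in> S \<and> dist (?p y) (?p x) < e \<and> dist (?q y) (?q x) < e"
      by eventually_elim auto
    then obtain d where d: "d > 0"
      "\<And>y. dist y x < d \<Longrightarrow> y \<in> S \<and> dist (?p y) (?p x) < e \<and> dist (?q y) (?q x) < e"
      unfolding eventually_nhds_metric by blast
    \<comment> \<open>so that the parallelogram with edges \<open>s u\<close> and \<open>s v\<close> stays
      within distance \<open>d\<close> of \<open>x\<close>; the \<open>1\<close> avoids
      division by zero\<close>
    define s where "s = d / (norm u + norm v + 1)"
    have pos: "norm u + norm v + 1 > 0" by (smt (verit) norm_ge_zero)
    have "s > 0" using d pos by (simp add: s_def)
    have near: "dist (x + a *\<^sub>R u + b *\<^sub>R v) x < d" if "a \<in> {0..s}" "b \<in> {0..s}" for a b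
    proof -
      have "norm (a *\<^sub>R u + b *\<^sub>R v) \<le> a * norm u + b * norm v"
        using that by (intro norm_triangle_le) auto
      also have "\<dots> \<le> s * norm u + s * norm v"
        using that by (intro add_mono mult_right_mono) auto
      also have "\<dots> < s * (norm u + norm v + 1)"
        using \<open>s > 0\<close> by (simp add: algebra_simps)
      also have "\<dots> = d" using pos by (simp add: s_def)
      finally show ?thesis by (simp add: dist_norm add.assoc)
    qed
    let ?f = "\<lambda>y. f y \<bullet> b"
    have g': "(?f has_derivative (\<lambda>w. f' y w \<bullet> b)) (at y)" if "dist y x < d" for y
      using f' d(2)[OF that] by (intro has_derivative_inner_left) auto
    have g'': "((\<lambda>z. f' z w \<bullet> b) has_derivative (\<lambda>w'. f'' w y w' \<bullet> b)) (at y)"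
      if "dist y x < d" for y w
      using f'' d(2)[OF that] by (intro has_derivative_inner_left) auto
    obtain a1 b1 where 1: "a1 \<in> {0..s}" "b1 \<in> {0..s}"
      "?f (x + s *\<^sub>R u + s *\<^sub>R v) - ?f (x + s *\<^sub>R u) - ?f (x + s *\<^sub>R v) + ?f x
        = s\<^sup>2 * ?q (x + a1 *\<^sub>R u + b1 *\<^sub>R v)"
      by (rule second_difference_mean_value[where S = "{y. dist y x < d}", OF \<open>s > 0\<close> _ g' g''])
         (use near in auto)
    obtain a2 b2 where 2: "a2 \<in> {0..s}" "b2 \<in> {0..s}"
      "?f (x + s *\<^sub>R v + s *\<^sub>R u) - ?f (x + s *\<^sub>R v) - ?f (x + s *\<^sub>R u) + ?f x
        = s\<^sup>2 * ?p (x + a2 *\<^sub>R v + b2 *\<^sub>R u)"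
    proof (rule second_difference_mean_value[where S = "{y. dist y x < d}", OF \<open>s > 0\<close> _ g' g''])
      show "x + a *\<^sub>R v + b *\<^sub>R u \<in> {y. dist y x < d}" if "a \<in> {0..s}" "b \<in> {0..s}" for a b
        using near[OF that(2,1)] by (simp add: add.assoc add.commute[of "a *\<^sub>R v"])
    qed blast+
    have "s\<^sup>2 * ?q (x + a1 *\<^sub>R u + b1 *\<^sub>R v) = s\<^sup>2 * ?p (x + b2 *\<^sub>R u + a2 *\<^sub>R v)"
      using 1(3) 2(3) by (simp add: algebra_simps)
    then have "?q (x + a1 *\<^sub>R u + b1 *\<^sub>R v) = ?p (x + b2 *\<^sub>R u + a2 *\<^sub>R v)"
      using \<open>s > 0\<close> by simp
    moreover have "dist (?q (x + a1 *\<^sub>R u + b1 *\<^sub>R v)) (?q x) < e"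
      "dist (?p (x + b2 *\<^sub>R u + a2 *\<^sub>R v)) (?p x) < e"
      using d(2) near 1 2 by blast+
    ultimately show False unfolding e_def dist_real_def by (smt (verit) field_sum_of_halves)
  qed
qed

abbreviation D :: "('a::real_normed_vector \<Rightarrow> 'b::real_normed_vector) \<Rightarrow> 'a \<Rightarrow> 'a \<Rightarrow> 'b"
  where "D f x \<equiv> frechet_derivative f (at x)"

lemma smooth_on_imp:
  assumes "smooth_on S f" "x \<in> S"
  shows smooth_on_derivative: "(f has_derivative D f x) (at x)"
    and smooth_on_derivative2: "((\<lambda>y. D f y v) has_derivative D (\<lambda>y. D f y v) x) (at x)"
    and smooth_on_continuous_derivative2: "isCont (\<lambda>y. D (\<lambda>y. D f y v) y u) x"
proof -
  have "open S" and C: "Ck_on (Suc (Suc 0)) f S"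
    using assms by (auto simp: smooth_on_def)
  show "(f has_derivative D f x) (at x)"
    using C assms by (simp flip: frechet_derivative_works)
  show "((\<lambda>y. D f y v) has_derivative D (\<lambda>y. D f y v) x) (at x)"
    using C assms by (simp flip: frechet_derivative_works)
  show "isCont (\<lambda>y. D (\<lambda>y. D f y v) y u) x"
    using C assms \<open>open S\<close> by (simp add: continuous_on_eq_continuous_at)
qed

lemma smooth_on_symmetric_derivative2:
  assumes "smooth_on S f" "x \<in> S"
  shows "D (\<lambda>y. D f y v) x u = D (\<lambda>y. D f y u) x v"
proof (rule symmetric_second_derivative[where S = S and f' = "D f"])
  show "open S" using assms by (simp add: smooth_on_def)
  then show "continuous_on S (\<lambda>y. D (\<lambda>y. D f y w) y w')" for w w'
    using smooth_on_continuous_derivative2[OF assms(1)] by (simp add: continuous_on_eq_continuous_at)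
qed (use assms smooth_on_derivative smooth_on_derivative2 in auto)

lemma smooth_on_continuous: "smooth_on S f \<Longrightarrow> x \<in> S \<Longrightarrow> isCont f x"
  using smooth_on_derivative has_derivative_continuous by blast

section \<open>Support planes of the unit ball\<close>

definition orthonormal_frame :: "real^3 \<Rightarrow> real^3 \<Rightarrow> real^3 \<Rightarrow> bool" where
  "orthonormal_frame e1 e2 e3 \<longleftrightarrow> norm e1 = 1 \<and> norm e2 = 1 \<and> norm e3 = 1 \<and>
     e1 \<bullet> e2 = 0 \<and> e1 \<bullet> e3 = 0 \<and> e2 \<bullet> e3 = 0"

lemma orthonormal_frame_inner:
  assumes "orthonormal_frame e1 e2 e3"
  shows "e1 \<bullet> e1 = 1" "e2 \<bullet> e2 = 1" "e3 \<bullet> e3 = 1" "e1 \<bullet> e2 = 0" "e1 \<bullet> e3 = 0" "e2 \<bullet> e3 = 0"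
    "e2 \<bullet> e1 = 0" "e3 \<bullet> e1 = 0" "e3 \<bullet> e2 = 0"
  using assms by (auto simp: orthonormal_frame_def norm_eq_1 inner_commute)

text \<open>Otherwise \<open>v\<close> would extend the frame to four independent vectors of three-space.\<close>

lemma orthonormal_frame_eq_0:
  assumes "orthonormal_frame e1 e2 e3" and v: "v \<bullet> e1 = 0" "v \<bullet> e2 = 0" "v \<bullet> e3 = 0"
  shows "v = 0"
proof (rule ccontr)
  assume "v \<noteq> 0"
  note e = orthonormal_frame_inner[OF assms(1)]
  have ne: "e1 \<noteq> 0" "e2 \<noteq> 0" "e3 \<noteq> 0" "e1 \<noteq> e2" "e1 \<noteq> e3" "e2 \<noteq> e3" "e1 \<noteq> v" "e2 \<noteq> v" "e3 \<noteq> v"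
    using e v by auto
  have "pairwise orthogonal {e1, e2, e3, v}"
    using e v by (auto simp: pairwise_def orthogonal_def inner_commute)
  then have "independent {e1, e2, e3, v}"
    using ne \<open>v \<noteq> 0\<close> by (intro pairwise_orthogonal_independent) auto
  then have "card {e1, e2, e3, v} \<le> 3"
    using independent_bound by force
  then show False using ne by simp
qed

definition graph_map ::
  "real^3 \<Rightarrow> real^3 \<Rightarrow> real^3 \<Rightarrow> (real^2 \<Rightarrow> real) \<Rightarrow> real^2 \<Rightarrow> real^3" where
  "graph_map e1 e2 e3 h = (\<lambda>w. (w $ 1) *\<^sub>R e1 + (w $ 2) *\<^sub>R e2 + h w *\<^sub>R e3)"

text \<open>The Euclidean normal of the graph, deliberately not scaled to unit length: it is then affine
  in the first derivatives of \<open>h\<close>, and its derivative is given by the Hessian of \<open>h\<close>.\<close>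

definition graph_normal ::
  "real^3 \<Rightarrow> real^3 \<Rightarrow> real^3 \<Rightarrow> (real^2 \<Rightarrow> real) \<Rightarrow> real^2 \<Rightarrow> real^3" where
  "graph_normal e1 e2 e3 h w = e3 - D h w (axis 1 1) *\<^sub>R e1 - D h w (axis 2 1) *\<^sub>R e2"

lemma graph_map_derivative:
  assumes "(h has_derivative h') (at w)"
  shows "(graph_map e1 e2 e3 h has_derivative
    (\<lambda>v. (v $ 1) *\<^sub>R e1 + (v $ 2) *\<^sub>R e2 + h' v *\<^sub>R e3)) (at w)"
  unfolding graph_map_def
  by (auto intro!: derivative_eq_intros assms bounded_linear.has_derivative[OF bounded_linear_vec_nth])

text \<open>The second partial derivatives of a graph parametrization are multiples of \<open>e3\<close>, so the
  numerator \<open>L N - M\<^sup>2\<close> of the curvature is the Hessian determinant of \<open>h\<close> times the square of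
  the component of the unit normal along \<open>e3\<close>. The denominator is non-negative by the
  Cauchy-Schwarz inequality. This settles the sign without computing the normal.\<close>

lemma hessian_graph_pos:
  assumes e: "orthonormal_frame e1 e2 e3" and h: "smooth_on W h" and w: "w \<in> W"
    and pos: "gauss_curvature (graph_map e1 e2 e3 h) w > 0"
  shows "(D (\<lambda>y. D h y (axis 2 1)) w (axis 1 1))\<^sup>2
    < D (\<lambda>y. D h y (axis 1 1)) w (axis 1 1) * D (\<lambda>y. D h y (axis 2 1)) w (axis 2 1)"
proof -
  let ?X = "graph_map e1 e2 e3 h"
  let ?H = "\<lambda>i j. D (\<lambda>y. D h y (axis j 1)) w (axis i 1)"
  have "open W" using h by (simp add: smooth_on_def)
  have X1: "pderiv2 j ?X y = (axis j 1 $ 1) *\<^sub>R e1 + (axis j 1 $ 2) *\<^sub>R e2 + D h y (axis j 1) *\<^sub>R e3"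
    if "y \<in> W" for j y
    unfolding pderiv2_def
    by (simp flip: frechet_derivative_at[OF graph_map_derivative[OF smooth_on_derivative[OF h that]]])
  have X2: "pderiv2 i (pderiv2 j ?X) w = ?H i j *\<^sub>R e3" for i j
  proof -
    have "((\<lambda>y. (axis j 1 $ 1) *\<^sub>R e1 + (axis j 1 $ 2) *\<^sub>R e2 + D h y (axis j 1) *\<^sub>R e3)
        has_derivative (\<lambda>v. D (\<lambda>y. D h y (axis j 1)) w v *\<^sub>R e3)) (at w)"
      by (auto intro!: derivative_eq_intros smooth_on_derivative2[OF h w])
    then have "(pderiv2 j ?X has_derivative (\<lambda>v. D (\<lambda>y. D h y (axis j 1)) w v *\<^sub>R e3)) (at w)"
      by (rule has_derivative_transform_within_open[OF _ \<open>open W\<close> w]) (simp add: X1)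
    from frechet_derivative_at[OF this] show ?thesis
      unfolding pderiv2_def[of i] by (simp add: fun_eq_iff)
  qed
  let ?n = "e3 \<bullet> unit_normal ?X w"
  let ?E = "fff ?X 1 1 w * fff ?X 2 2 w - (fff ?X 1 2 w)\<^sup>2"
  have "gauss_curvature ?X w = ?n\<^sup>2 * (?H 1 1 * ?H 2 2 - (?H 1 2)\<^sup>2) / ?E"
    by (simp add: gauss_curvature_def sff_def X2 algebra_simps power2_eq_square)
  moreover have "?E \<ge> 0"
    using Cauchy_Schwarz_ineq by (simp add: fff_def)
  ultimately have "?n\<^sup>2 * (?H 1 1 * ?H 2 2 - (?H 1 2)\<^sup>2) > 0"
    using pos by (auto simp: zero_less_divide_iff)
  then show ?thesis
    by (simp add: zero_less_mult_iff)
qed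

text \<open>The form in which Birkhoff orthogonality is used throughout: \<open>x\<close> maximizes over the unit
  ball a linear functional with kernel \<open>H\<close>.\<close>

lemma birkhoff_support_functional:
  assumes "birkhoff_orthogonal N x H" "N x = 1"
  obtains a where "a \<noteq> 0" "H = {v. a \<bullet> v = 0}" "\<And>y. N y \<le> 1 \<Longrightarrow> a \<bullet> y \<le> a \<bullet> x"
proof -
  obtain a b where a: "a \<noteq> 0" and P: "(\<lambda>h. x + h) ` H = {y. a \<bullet> y = b}"
    and B: "unit_ball N \<subseteq> {y. a \<bullet> y \<le> b}"
    using assms unfolding birkhoff_orthogonal_def supports_def by auto
  have "0 \<in> H" using assms by (simp add: birkhoff_orthogonal_def subspace_0)
  then have b: "b = a \<bullet> x"
    using P by force
  have "v \<in> H \<longleftrightarrow> x + v \<in> (\<lambda>h. x + h) ` H" for v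
    by auto
  then have "v \<in> H \<longleftrightarrow> a \<bullet> v = 0" for v
    unfolding P b by (simp add: inner_add_right)
  then show thesis using that[OF a] B b by (auto simp: unit_ball_def)
qed

lemma same_kernel_imp_scaled:
  fixes a a' :: "'a::real_inner"
  assumes "a \<noteq> 0" "\<And>v. a \<bullet> v = 0 \<Longrightarrow> a' \<bullet> v = 0"
  obtains t where "a' = t *\<^sub>R a"
proof -
  define t where "t = (a \<bullet> a') / (a \<bullet> a)"
  let ?v = "a' - t *\<^sub>R a"
  have 1: "a \<bullet> ?v = 0" using assms(1) by (simp add: t_def inner_diff_right)
  then have "?v \<bullet> ?v = 0"
    using assms(2)[OF 1] by (simp add: inner_diff_left)
  then show thesis using that[of t] by simp
qed

text \<open>The set of maximizers over the ball is convex, and since the maximum is positive it lies in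
  the unit sphere; so the segment from \<open>x\<close> to \<open>y\<close> would lie in the sphere.\<close>

lemma strictly_convex_support_unique:
  assumes N: "is_norm N" "strictly_convex_norm N" and "a \<noteq> 0" "N x = 1" "N y = 1"
    and x: "\<And>z. N z \<le> 1 \<Longrightarrow> a \<bullet> z \<le> a \<bullet> x" and y: "\<And>z. N z \<le> 1 \<Longrightarrow> a \<bullet> z \<le> a \<bullet> y"
  shows "x = y"
proof (rule ccontr)
  assume "x \<noteq> y"
  have pos: "N z > 0" if "z \<noteq> 0" for z
    using N(1) that unfolding is_norm_def by (metis less_eq_real_def)
  have scale: "N (c *\<^sub>R z) = \<bar>c\<bar> * N z" and tri: "N (z + z') \<le> N z + N z'" for c z z'
    using N(1) by (auto simp: is_norm_def)
  have unit: "N (z /\<^sub>R N z) = 1" if "z \<noteq> 0" for z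
    using pos[OF that] by (simp add: scale)
  have eq: "a \<bullet> x = a \<bullet> y" using x[of y] y[of x] assms(4,5) by linarith
  have "0 < a \<bullet> (a /\<^sub>R N a)"
    using \<open>a \<noteq> 0\<close> pos by simp
  also have "\<dots> \<le> a \<bullet> x" using unit[OF \<open>a \<noteq> 0\<close>] by (intro x) simp
  finally have ax: "a \<bullet> x > 0" .
  have seg: "N z = 1" if z: "z \<in> closed_segment x y" for z
  proof -
    obtain t where t: "0 \<le> t" "t \<le> 1" and z: "z = (1 - t) *\<^sub>R x + t *\<^sub>R y"
      using z by (auto simp: closed_segment_def)
    have az: "a \<bullet> z = a \<bullet> x" using eq by (simp add: z inner_add_right algebra_simps)
    then have "z \<noteq> 0" using ax by auto
    have "N z \<le> 1"
      using tri[of "(1 - t) *\<^sub>R x" "t *\<^sub>R y"] t assms by (simp add: z scale)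
    moreover have "a \<bullet> (z /\<^sub>R N z) \<le> a \<bullet> x"
      using unit[OF \<open>z \<noteq> 0\<close>] by (intro x) simp
    then have "N z \<ge> 1"
      using ax pos[OF \<open>z \<noteq> 0\<close>] by (simp add: az field_simps)
    ultimately show ?thesis by simp
  qed
  then show False
    using N(2) \<open>x \<noteq> y\<close> by (auto simp: strictly_convex_norm_def unit_sphere_def)
qed

text \<open>Functionals with the same kernel \<open>H\<close> are proportional. Depending on the sign of the factor,
  \<open>y\<close> or \<open>- y\<close> maximizes the same functional as \<open>x\<close>.\<close>

lemma birkhoff_normal_unique:
  assumes N: "is_norm N" "strictly_convex_norm N"
    and x: "birkhoff_orthogonal N x H" "N x = 1" and y: "birkhoff_orthogonal N y H" "N y = 1"
  shows "y = x \<or> y = - x"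
proof -
  obtain a where a: "a \<noteq> 0" "H = {v. a \<bullet> v = 0}" "\<And>z. N z \<le> 1 \<Longrightarrow> a \<bullet> z \<le> a \<bullet> x"
    using birkhoff_support_functional[OF x] by metis
  obtain a' where a': "a' \<noteq> 0" "H = {v. a' \<bullet> v = 0}" "\<And>z. N z \<le> 1 \<Longrightarrow> a' \<bullet> z \<le> a' \<bullet> y"
    using birkhoff_support_functional[OF y] by metis
  obtain t where t: "a' = t *\<^sub>R a"
    using same_kernel_imp_scaled[OF a(1)] a(2) a'(2) by blast
  have minus: "N (- z) = N z" for z
    using N(1) unfolding is_norm_def by (metis abs_minus_cancel abs_one mult_1 scaleR_minus1_left)
  consider "t > 0" | "t < 0" using t a'(1) by fastforce
  then show ?thesis
  proof cases
    case 1
    have "a \<bullet> z \<le> a \<bullet> y" if "N z \<le> 1" for z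
      using a'(3)[OF that] 1 by (simp add: t)
    then show ?thesis using strictly_convex_support_unique[OF N a(1) x(2) y(2) a(3)] by blast
  next
    case 2
    have "a \<bullet> z \<le> a \<bullet> (- y)" if "N z \<le> 1" for z
    proof -
      have "t * (a \<bullet> (- y)) \<le> t * (a \<bullet> z)"
        using a'(3)[of "- z"] that by (simp add: t minus)
      then show ?thesis using 2 by (simp only: mult_le_cancel_left_neg)
    qed
    then have "x = - y"
      using strictly_convex_support_unique[OF N a(1) x(2) _ a(3), of "- y"] y(2) by (simp add: minus)
    then show ?thesis by simp
  qed
qed

text \<open>Smoothness of the sphere leaves only one candidate for the plane \<open>H\<close>, its tangent plane:
  restricted to the graph, the support functional has a maximum in the interior of the
  parameter domain, hence annihilates the tangent vectors \<open>e1 + h\<^sub>1 e3\<close> and \<open>e2 + h\<^sub>2 e3\<close>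
  and is a multiple of \<open>graph_normal\<close>.\<close>

lemma birkhoff_orthogonal_graph:
  assumes e: "orthonormal_frame e1 e2 e3" and W: "open W" "w \<in> W"
    and h: "(h has_derivative D h w) (at w)"
    and S: "graph_map e1 e2 e3 h ` W \<subseteq> unit_sphere N"
    and H: "birkhoff_orthogonal N (graph_map e1 e2 e3 h w) H"
  shows "H = {v. graph_normal e1 e2 e3 h w \<bullet> v = 0}"
proof -
  let ?X = "graph_map e1 e2 e3 h" and ?\<nu> = "graph_normal e1 e2 e3 h w"
  have "N (?X w) = 1" using S W by (auto simp: unit_sphere_def)
  from birkhoff_support_functional[OF H this] obtain a
    where a: "a \<noteq> 0" "H = {v. a \<bullet> v = 0}" "\<And>y. N y \<le> 1 \<Longrightarrow> a \<bullet> y \<le> a \<bullet> ?X w"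
    by metis
  have der: "((\<lambda>y. a \<bullet> ?X y) has_derivative
      (\<lambda>v. a \<bullet> ((v $ 1) *\<^sub>R e1 + (v $ 2) *\<^sub>R e2 + D h w v *\<^sub>R e3))) (at w)"
    by (intro has_derivative_inner_right graph_map_derivative h)
  have "a \<bullet> ?X y \<le> a \<bullet> ?X w" if "y \<in> W" for y
    using S that by (intro a(3)) (auto simp: unit_sphere_def)
  then have "(\<lambda>v. a \<bullet> ((v $ 1) *\<^sub>R e1 + (v $ 2) *\<^sub>R e2 + D h w v *\<^sub>R e3)) = (\<lambda>v. 0)"
    by (intro differential_zero_maxmin[OF W(2,1) der]) simp
  then have 0: "a \<bullet> ((v $ 1) *\<^sub>R e1 + (v $ 2) *\<^sub>R e2 + D h w v *\<^sub>R e3) = 0" for v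
    by (rule fun_cong)
  have "a \<bullet> e1 + D h w (axis 1 1) * (a \<bullet> e3) = 0" "a \<bullet> e2 + D h w (axis 2 1) * (a \<bullet> e3) = 0"
    using 0[of "axis 1 1"] 0[of "axis 2 1"] by (simp_all add: inner_add_right axis_def)
  then have "(a - (a \<bullet> e3) *\<^sub>R ?\<nu>) \<bullet> e1 = 0" "(a - (a \<bullet> e3) *\<^sub>R ?\<nu>) \<bullet> e2 = 0"
      "(a - (a \<bullet> e3) *\<^sub>R ?\<nu>) \<bullet> e3 = 0"
    by (simp_all add: graph_normal_def inner_diff_left orthonormal_frame_inner[OF e] mult.commute)
  then have "a - (a \<bullet> e3) *\<^sub>R ?\<nu> = 0"
    by (rule orthonormal_frame_eq_0[OF e])
  then have eq: "a = (a \<bullet> e3) *\<^sub>R ?\<nu>"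
    by (rule right_minus_eq[THEN iffD1])
  have nz: "a \<bullet> e3 \<noteq> 0"
  proof
    assume "a \<bullet> e3 = 0"
    from eq[unfolded this] a(1) show False by simp
  qed
  have "a \<bullet> v = 0 \<longleftrightarrow> ?\<nu> \<bullet> v = 0" for v
  proof -
    have "a \<bullet> v = (a \<bullet> e3) * (?\<nu> \<bullet> v)"
      using arg_cong[OF eq, of "\<lambda>x. x \<bullet> v"] by (simp only: inner_scaleR_left)
    then show ?thesis using nz by simp
  qed
  then show ?thesis using a(2) by simp
qed

lemma admissible_norm_chart:
  assumes "admissible_norm N" "N x = 1"
  obtains e1 e2 e3 h W V y where
    "orthonormal_frame e1 e2 e3" "smooth_on W h" "open V"
    "unit_sphere N \<inter> V = graph_map e1 e2 e3 h ` W" "y \<in> W" "x = graph_map e1 e2 e3 h y"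
    "\<And>w. w \<in> W \<Longrightarrow> gauss_curvature (graph_map e1 e2 e3 h) w > 0"
proof -
  have "x \<in> unit_sphere N" using assms by (simp add: unit_sphere_def)
  then obtain W X where X: "graph_chart (unit_sphere N) W X" "x \<in> X ` W"
    using assms by (auto simp: admissible_norm_def smooth_norm_def)
  have "\<forall>w\<in>W. gauss_curvature X w > 0"
    using assms X by (simp add: admissible_norm_def positively_curved_norm_def)
  moreover obtain e1 e2 e3 h V where "orthonormal_frame e1 e2 e3" "smooth_on W h" "open V"
      "unit_sphere N \<inter> V = X ` W" "X = graph_map e1 e2 e3 h"
    using X(1) unfolding graph_chart_def orthonormal_frame_def graph_map_def by blast
  ultimately show thesis
    using that X(2) by blast
qed

text \<open>Reflection in the origin preserves the ball and \<open>H\<close> and exchanges the two support planes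
  parallel to \<open>H\<close>.\<close>

lemma birkhoff_orthogonal_minus:
  assumes "is_norm N" "birkhoff_orthogonal N (- v) H"
  shows "birkhoff_orthogonal N v H"
proof -
  have minus: "N (- z) = N z" for z
    using assms(1) unfolding is_norm_def by (metis abs_minus_cancel abs_one mult_1 scaleR_minus1_left)
  have v: "v \<noteq> 0" and H: "subspace H" "dim H = 2"
    and "supports ((\<lambda>h. - v /\<^sub>R N v + h) ` H) (unit_ball N)"
    using assms(2) by (auto simp: birkhoff_orthogonal_def minus)
  then obtain a b where a: "a \<noteq> 0" and P: "(\<lambda>h. - v /\<^sub>R N v + h) ` H = {y. a \<bullet> y = b}"
    and B: "unit_ball N \<subseteq> {y. a \<bullet> y \<le> b}" and ne: "{y. a \<bullet> y = b} \<inter> unit_ball N \<noteq> {}"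
    unfolding supports_def by metis
  have P': "y \<in> (\<lambda>h. v /\<^sub>R N v + h) ` H \<longleftrightarrow> - y \<in> (\<lambda>h. - v /\<^sub>R N v + h) ` H" for y
  proof -
    have "y \<in> (\<lambda>h. v /\<^sub>R N v + h) ` H \<longleftrightarrow> y - v /\<^sub>R N v \<in> H"
      by (auto simp: image_iff algebra_simps intro: bexI[of _ "y - v /\<^sub>R N v"])
    also have "\<dots> \<longleftrightarrow> - (y - v /\<^sub>R N v) \<in> H"
      using H(1) subspace_neg by fastforce
    also have "\<dots> \<longleftrightarrow> - y \<in> (\<lambda>h. - v /\<^sub>R N v + h) ` H"
      by (auto simp: image_iff algebra_simps intro: bexI[of _ "- y + v /\<^sub>R N v"])
    finally show ?thesis .
  qed
  have "supports ((\<lambda>h. v /\<^sub>R N v + h) ` H) (unit_ball N)"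
    unfolding supports_def
  proof (intro exI conjI)
    show "- a \<noteq> 0" using a by simp
    show eq: "(\<lambda>h. v /\<^sub>R N v + h) ` H = {y. - a \<bullet> y = b}"
      by (rule set_eqI, subst P', subst P) auto
    show "unit_ball N \<subseteq> {y. - a \<bullet> y \<le> b}"
    proof
      fix y assume "y \<in> unit_ball N"
      then have "- y \<in> unit_ball N" by (simp add: unit_ball_def minus)
      then show "y \<in> {y. - a \<bullet> y \<le> b}" using B by force
    qed
    obtain y where "a \<bullet> y = b" "N y \<le> 1" using ne by (auto simp: unit_ball_def)
    then have "- y \<in> {y. - a \<bullet> y = b} \<inter> unit_ball N"
      by (simp add: unit_ball_def minus)
    then show "(\<lambda>h. v /\<^sub>R N v + h) ` H \<inter> unit_ball N \<noteq> {}"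
      unfolding eq by blast
  qed
  then show ?thesis using v H by (simp add: birkhoff_orthogonal_def)
qed

lemma birkhoff_orthogonal_unique_plane:
  assumes N: "admissible_norm N" and x: "N x = 1"
  obtains a where "a \<noteq> 0" "\<And>H. birkhoff_orthogonal N x H \<Longrightarrow> H = {v. a \<bullet> v = 0}"
proof -
  obtain e1 e2 e3 h W V y where e: "orthonormal_frame e1 e2 e3" and h: "smooth_on W h" "y \<in> W"
    and S: "unit_sphere N \<inter> V = graph_map e1 e2 e3 h ` W" and x: "x = graph_map e1 e2 e3 h y"
    by (rule admissible_norm_chart[OF assms])
  let ?a = "graph_normal e1 e2 e3 h y"
  have "?a \<bullet> e3 = 1"
    by (simp add: graph_normal_def inner_diff_left orthonormal_frame_inner[OF e])
  then have "?a \<noteq> 0" by auto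
  moreover have "H = {v. ?a \<bullet> v = 0}" if "birkhoff_orthogonal N x H" for H
    using birkhoff_orthogonal_graph[OF e, of W y h N H] h S that
    by (auto simp: x smooth_on_def smooth_on_derivative[OF h])
  ultimately show thesis using that by blast
qed

section \<open>Umbilic points in coordinates\<close>

text \<open>For injective \<open>L\<close> these are the eigenvalues of \<open>E \<circ> inv L\<close> on the range of \<open>L\<close>. With \<open>L\<close> and
  \<open>E\<close> the coordinate differentials of the immersion and of a Birkhoff normal field they are
  the principal curvatures, in a form that makes no mention of the inverse.\<close>

definition rel_eigenvalues :: "(real^2 \<Rightarrow> real^3) \<Rightarrow> (real^2 \<Rightarrow> real^3) \<Rightarrow> real set" where
  "rel_eigenvalues E L = {k. \<exists>u. u \<noteq> 0 \<and> E u = k *\<^sub>R L u}"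

lemma vec2_expand: "(u :: real^2) = (u $ 1) *\<^sub>R axis 1 1 + (u $ 2) *\<^sub>R axis 2 1"
  by (simp add: vec_eq_iff forall_2 axis_def)

text \<open>In the plane, the kernel of a non-zero functional is a line, complementary to any vector
  outside it.\<close>

lemma plane_kernel:
  fixes \<phi> :: "real^2 \<Rightarrow> real"
  assumes lin: "linear \<phi>" and u: "\<phi> u \<noteq> 0"
  obtains v where "v \<noteq> 0" "\<phi> v = 0" "\<And>z. \<phi> z = 0 \<Longrightarrow> \<exists>t. z = t *\<^sub>R v"
    "\<And>z. \<exists>s t. z = s *\<^sub>R u + t *\<^sub>R v"
proof -
  let ?a = "\<phi> (axis 1 1)" and ?b = "\<phi> (axis 2 1)"
  have \<phi>: "\<phi> z = (z $ 1) * ?a + (z $ 2) * ?b" for z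
    by (subst vec2_expand[of z]) (simp add: linear_add[OF lin] linear_cmul[OF lin])
  define v :: "real^2" where "v = (- ?b) *\<^sub>R axis 1 1 + ?a *\<^sub>R axis 2 1"
  have v12: "v $ 1 = - ?b" "v $ 2 = ?a"
    by (simp_all add: v_def axis_def)
  have nz: "?a \<noteq> 0 \<or> ?b \<noteq> 0" using u by (auto simp: \<phi>[of u])
  have ker: "\<exists>t. z = t *\<^sub>R v" if "\<phi> z = 0" for z
  proof (cases "?a = 0")
    case True
    then have "z = (- (z $ 1) / ?b) *\<^sub>R v"
      using nz that \<phi>[of z] by (simp add: vec_eq_iff forall_2 v12)
    then show ?thesis by blast
  next
    case False
    then have "z = ((z $ 2) / ?a) *\<^sub>R v"
      using that \<phi>[of z] by (simp add: vec_eq_iff forall_2 v12 field_simps)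
    then show ?thesis by blast
  qed
  have "\<exists>s t. z = s *\<^sub>R u + t *\<^sub>R v" for z
  proof -
    have "\<phi> (z - (\<phi> z / \<phi> u) *\<^sub>R u) = 0"
      using u by (simp add: linear_diff[OF lin] linear_cmul[OF lin])
    then obtain t where "z - (\<phi> z / \<phi> u) *\<^sub>R u = t *\<^sub>R v" using ker by blast
    then have "z = (\<phi> z / \<phi> u) *\<^sub>R u + t *\<^sub>R v" by (simp add: algebra_simps)
    then show ?thesis by blast
  qed
  moreover have "v \<noteq> 0" using nz by (auto simp: vec_eq_iff forall_2 v12)
  moreover have "\<phi> v = 0" using \<phi>[of v] by (simp add: v12)
  ultimately show thesis using that ker by blast
qed

text \<open>\<open>E\<close> stands for the endomorphism \<open>E \<circ> inv L\<close> of the plane \<open>range L\<close>, which \<open>sym\<close> makes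
  self-adjoint for \<open>B\<close>. The \<open>B\<close>-orthogonal complement of an eigenvector is then invariant, and
  in dimension two it is a line, hence spanned by a second eigenvector. If there is only one
  eigenvalue, the endomorphism is a multiple of the identity. Because of \<open>definite\<close> the
  eigenvector does not lie in its own complement.\<close>

lemma selfadjoint_single_eigenvalue:
  fixes L E :: "real^2 \<Rightarrow> real^3" and B :: "real^3 \<Rightarrow> real^3 \<Rightarrow> real"
  assumes lin: "linear L" "linear E" and ran: "range E \<subseteq> range L"
    and B: "\<And>x. linear (B x)" "\<And>x y. B x y = B y x"
    and definite: "\<And>u. u \<noteq> 0 \<Longrightarrow> B (L u) (L u) \<noteq> 0"
    and sym: "\<And>u v. B (E u) (L v) = B (E v) (L u)"
    and ev: "rel_eigenvalues E L = {k}"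
  shows "E u = k *\<^sub>R L u"
proof -
  obtain e where e: "e \<noteq> 0" "E e = k *\<^sub>R L e"
    using ev unfolding rel_eigenvalues_def by blast
  have "linear (\<lambda>v. B (L e) (L v))"
    using linear_compose[OF lin(1) B(1)] by (simp add: o_def)
  from plane_kernel[OF this definite[OF e(1)]] obtain v where v: "v \<noteq> 0" "B (L e) (L v) = 0"
    and ker: "\<And>z. B (L e) (L z) = 0 \<Longrightarrow> \<exists>t. z = t *\<^sub>R v"
    and span: "\<And>z. \<exists>s t. z = s *\<^sub>R e + t *\<^sub>R v"
    by metis
  obtain z where z: "E v = L z" using ran by blast
  have "B (L e) (L z) = B (L v) (E e)"
    using sym[of v e] B(2) z by metis
  also have "\<dots> = 0"
    using v(2) B(2) by (simp add: e(2) linear_cmul[OF B(1)])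
  finally obtain t where "z = t *\<^sub>R v" using ker by blast
  then have Ev: "E v = t *\<^sub>R L v" using z by (simp add: linear_cmul[OF lin(1)])
  then have "t \<in> rel_eigenvalues E L" using v(1) unfolding rel_eigenvalues_def by blast
  then have "t = k" using ev by simp
  obtain s r where u: "u = s *\<^sub>R e + r *\<^sub>R v" using span by blast
  show ?thesis
    unfolding u linear_add[OF lin(1)] linear_add[OF lin(2)] linear_cmul[OF lin(1)] linear_cmul[OF lin(2)]
    by (simp add: e(2) Ev \<open>t = k\<close> scaleR_add_right mult.commute)
qed

lemma definite_binary_form:
  fixes a b c x y :: real
  assumes "b\<^sup>2 < a * c" "a * x * x + 2 * b * x * y + c * y * y = 0"
  shows "x = 0 \<and> y = 0"
proof -
  have "(a * x + b * y)\<^sup>2 + (a * c - b\<^sup>2) * y\<^sup>2 = a * (a * x * x + 2 * b * x * y + c * y * y)"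
    by (simp add: power2_eq_square algebra_simps)
  also have "\<dots> = 0" using assms(2) by simp
  finally have *: "(a * x + b * y)\<^sup>2 + (a * c - b\<^sup>2) * y\<^sup>2 = 0" .
  have "(a * c - b\<^sup>2) * y\<^sup>2 \<ge> 0" using assms(1) by simp
  then have "(a * x + b * y)\<^sup>2 = 0" "(a * c - b\<^sup>2) * y\<^sup>2 = 0"
    using * zero_le_power2[of "a * x + b * y"] by linarith+
  then have "y = 0" "a * x = 0" using assms(1) by auto
  moreover have "a \<noteq> 0" using assms(1) by (auto simp: not_less)
  ultimately show ?thesis by simp
qed

text \<open>The principal curvatures are the eigenvalues of a self-adjoint endomorphism, which is why a
  single eigenvalue forces \<open>d\<eta>\<close> to be a multiple of \<open>dF\<close>. Near \<open>\<eta> w\<close> the unit sphere is the graph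
  of a function \<open>h\<close>, and \<open>\<eta> = X \<circ> g\<close> for its parametrization \<open>X\<close>. The Euclidean normal \<open>\<nu> \<circ> g\<close> of
  the sphere is orthogonal to the surface \<open>F\<close>, because both have the same tangent plane.
  Differentiating \<open>(\<nu> \<circ> g) \<bullet> dF v = 0\<close> in direction \<open>u\<close> gives
  \<open>B (d\<eta> u) (dF v) = \<nu> \<bullet> d\<^sup>2F u v\<close>, where \<open>B\<close> is the Hessian form of \<open>h\<close> in the frame. The
  right-hand side is symmetric in \<open>u\<close> and \<open>v\<close>, and \<open>B\<close> is definite on the tangent plane since the
  sphere is positively curved.\<close>

lemma umbilic_imp_proportional:
  fixes F \<eta> :: "real^2 \<Rightarrow> real^3"
  assumes N: "admissible_norm N" and F: "smooth_on S F" and \<eta>: "smooth_on S \<eta>" and w: "w \<in> S"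
    and inj: "inj (D F w)"
    and normal: "\<And>y. y \<in> S \<Longrightarrow> N (\<eta> y) = 1" "\<And>y. y \<in> S \<Longrightarrow> birkhoff_orthogonal N (\<eta> y) (range (D F y))"
    and ev: "rel_eigenvalues (D \<eta> w) (D F w) = {k}"
  shows "D \<eta> w u = k *\<^sub>R D F w u"
proof -
  have "open S" using F by (simp add: smooth_on_def)
  obtain e1 e2 e3 h W V y0 where e: "orthonormal_frame e1 e2 e3" and h: "smooth_on W h" and "open V"
    and SV: "unit_sphere N \<inter> V = graph_map e1 e2 e3 h ` W" and y0: "y0 \<in> W"
    and \<eta>0: "\<eta> w = graph_map e1 e2 e3 h y0"
    and curv: "\<And>w. w \<in> W \<Longrightarrow> gauss_curvature (graph_map e1 e2 e3 h) w > 0"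
    by (rule admissible_norm_chart[OF N normal(1)[OF w]]) blast
  have "open W" using h by (simp add: smooth_on_def)
  note ee = orthonormal_frame_inner[OF e]
  define S' where "S' = S \<inter> \<eta> -` V"
  have "continuous_on S \<eta>"
    using smooth_on_continuous[OF \<eta>] by (simp add: continuous_at_imp_continuous_on)
  then have "open S'"
    unfolding S'_def using \<open>open S\<close> \<open>open V\<close> by (rule continuous_open_preimage)
  have "w \<in> S'" using w \<eta>0 y0 SV by (auto simp: S'_def)
  define g :: "real^2 \<Rightarrow> real^2" where "g y = (\<eta> y \<bullet> e1) *\<^sub>R axis 1 1 + (\<eta> y \<bullet> e2) *\<^sub>R axis 2 1" for y
  \<comment> \<open>\<open>g\<close> reads off the two graph coordinates of \<open>\<eta> y\<close>\<close>
  have gX: "g y = z" if "\<eta> y = graph_map e1 e2 e3 h z" for y z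
    unfolding g_def that graph_map_def by (simp add: inner_add_left ee vec_eq_iff forall_2 axis_def)
  have g: "g y \<in> W" "\<eta> y = graph_map e1 e2 e3 h (g y)" if "y \<in> S'" for y
  proof -
    have "\<eta> y \<in> graph_map e1 e2 e3 h ` W"
      using that normal(1) unfolding SV[symmetric] by (auto simp: S'_def unit_sphere_def)
    then show "g y \<in> W" "\<eta> y = graph_map e1 e2 e3 h (g y)" using gX by auto
  qed
  let ?\<nu> = "\<lambda>y. graph_normal e1 e2 e3 h (g y)"
  have T: "range (D F y) = {v. ?\<nu> y \<bullet> v = 0}" if "y \<in> S'" for y
  proof (rule birkhoff_orthogonal_graph[OF e \<open>open W\<close> g(1)[OF that]])
    show "birkhoff_orthogonal N (graph_map e1 e2 e3 h (g y)) (range (D F y))"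
      using normal(2)[of y] that g(2)[OF that] by (simp add: S'_def)
  qed (use SV smooth_on_derivative[OF h g(1)[OF that]] in auto)
  have g0: "g w = y0" using gX \<eta>0 by blast
  have g': "(g has_derivative (\<lambda>u. (D \<eta> w u \<bullet> e1) *\<^sub>R axis 1 1 + (D \<eta> w u \<bullet> e2) *\<^sub>R axis 2 1)) (at w)"
    unfolding g_def by (auto intro!: derivative_eq_intros smooth_on_derivative[OF \<eta> w])
  define H where "H i j = D (\<lambda>y. D h y (axis j 1)) y0 (axis i 1)" for i j :: 2
  have H12: "H 2 1 = H 1 2"
    unfolding H_def by (rule smooth_on_symmetric_derivative2[OF h y0])
  have Hpos: "(H 1 2)\<^sup>2 < H 1 1 * H 2 2"
    unfolding H_def by (rule hessian_graph_pos[OF e h y0 curv[OF y0]])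
  have h': "((\<lambda>y. D h (g y) (axis j 1)) has_derivative
      (\<lambda>u. (D \<eta> w u \<bullet> e1) * H 1 j + (D \<eta> w u \<bullet> e2) * H 2 j)) (at w)" for j
  proof -
    have d: "((\<lambda>y. D h y (axis j 1)) has_derivative D (\<lambda>y. D h y (axis j 1)) y0) (at (g w))"
      unfolding g0 by (rule smooth_on_derivative2[OF h y0])
    note lin = has_derivative_linear[OF d]
    show ?thesis
      using has_derivative_compose[OF g' d] by (simp add: linear_add[OF lin] linear_cmul[OF lin] H_def)
  qed
  define B where "B x z = H 1 1 * (x \<bullet> e1) * (z \<bullet> e1) + H 1 2 * ((x \<bullet> e1) * (z \<bullet> e2) + (x \<bullet> e2) * (z \<bullet> e1))
      + H 2 2 * (x \<bullet> e2) * (z \<bullet> e2)" for x z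
  have B: "B (D \<eta> w u) (D F w v) = ?\<nu> w \<bullet> D (\<lambda>y. D F y v) w u" for u v
  proof -
    have "((\<lambda>y. ?\<nu> y \<bullet> D F y v) has_derivative
      (\<lambda>u. ?\<nu> w \<bullet> D (\<lambda>y. D F y v) w u +
        (- (((D \<eta> w u \<bullet> e1) * H 1 1 + (D \<eta> w u \<bullet> e2) * H 2 1) *\<^sub>R e1)
         - ((D \<eta> w u \<bullet> e1) * H 1 2 + (D \<eta> w u \<bullet> e2) * H 2 2) *\<^sub>R e2) \<bullet> D F w v)) (at w)"
      unfolding graph_normal_def
      by (rule has_derivative_inner[OF _ smooth_on_derivative2[OF F w]])
         (auto intro!: derivative_eq_intros h')
    moreover have "((\<lambda>y. ?\<nu> y \<bullet> D F y v) has_derivative (\<lambda>u. 0)) (at w)"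
    proof (rule has_derivative_transform_within_open[OF has_derivative_const \<open>open S'\<close> \<open>w \<in> S'\<close>])
      show "0 = ?\<nu> y \<bullet> D F y v" if "y \<in> S'" for y
        using T[OF that] by auto
    qed
    ultimately have "?\<nu> w \<bullet> D (\<lambda>y. D F y v) w u +
        (- (((D \<eta> w u \<bullet> e1) * H 1 1 + (D \<eta> w u \<bullet> e2) * H 2 1) *\<^sub>R e1)
         - ((D \<eta> w u \<bullet> e1) * H 1 2 + (D \<eta> w u \<bullet> e2) * H 2 2) *\<^sub>R e2) \<bullet> D F w v = 0"
      using has_derivative_unique by (metis (mono_tags, lifting))
    then show ?thesis
      by (simp add: B_def H12 inner_diff_left inner_add_left inner_commute[of e1] inner_commute[of e2] algebra_simps)
  qed
  note linF = has_derivative_linear[OF smooth_on_derivative[OF F w]]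
  note lin\<eta> = has_derivative_linear[OF smooth_on_derivative[OF \<eta> w]]
  show ?thesis
  proof (rule selfadjoint_single_eigenvalue[where B = B, OF linF lin\<eta> _ _ _ _ _ ev])
    obtain a where a: "range (D F w) = {v. a \<bullet> v = 0}" "\<And>y. N y \<le> 1 \<Longrightarrow> a \<bullet> y \<le> a \<bullet> \<eta> w"
      using birkhoff_support_functional[OF normal(2)[OF w] normal(1)[OF w]] by metis
    \<comment> \<open>among the unit vectors \<open>\<eta> y\<close>, the support functional \<open>a\<close>
      is maximal at \<open>\<eta> w\<close>\<close>
    have "(\<lambda>u. a \<bullet> D \<eta> w u) = (\<lambda>u. 0)"
    proof (rule differential_zero_maxmin[OF w \<open>open S\<close>])
      show "((\<lambda>y. a \<bullet> \<eta> y) has_derivative (\<lambda>u. a \<bullet> D \<eta> w u)) (at w)"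
        by (intro has_derivative_inner_right smooth_on_derivative[OF \<eta> w])
    qed (use a(2) normal(1) in auto)
    then show "range (D \<eta> w) \<subseteq> range (D F w)"
      unfolding a(1) by (auto dest: fun_cong)
    show "linear (B x)" for x
      unfolding B_def by (rule linearI) (simp_all add: inner_add_left algebra_simps)
    show "B x z = B z x" for x z
      by (simp add: B_def algebra_simps)
    show "B (D F w u) (D F w u) \<noteq> 0" if "u \<noteq> 0" for u
    proof
      assume 0: "B (D F w u) (D F w u) = 0"
      have "D F w u \<bullet> e1 = 0 \<and> D F w u \<bullet> e2 = 0"
        by (rule definite_binary_form[OF Hpos]) (use 0 in \<open>simp add: B_def algebra_simps\<close>)
      moreover have "?\<nu> w \<bullet> D F w u = 0" using T[OF \<open>w \<in> S'\<close>] by auto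
      ultimately have "D F w u = 0"
        by (intro orthonormal_frame_eq_0[OF e]) (auto simp: graph_normal_def inner_diff_right inner_commute)
      then show False
        using inj \<open>u \<noteq> 0\<close> linear_injective_0[OF linF] by blast
    qed
    show "B (D \<eta> w u) (D F w v) = B (D \<eta> w v) (D F w u)" for u v
      unfolding B by (simp add: smooth_on_symmetric_derivative2[OF F w])
  qed
qed

text \<open>From \<open>d\<eta> = \<kappa> dF\<close> the symmetry of the second derivatives of \<open>F\<close> and \<open>\<eta>\<close> yields
  \<open>d\<kappa> u \<cdot> dF v = d\<kappa> v \<cdot> dF u\<close>. As \<open>dF\<close> is injective and the plane is two-dimensional, \<open>d\<kappa>\<close>
  vanishes, so \<open>\<kappa>\<close> is a constant \<open>k\<close> and \<open>\<eta> - k F\<close> has derivative zero.\<close>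

lemma proportional_imp_affine:
  fixes F \<eta> :: "real^2 \<Rightarrow> real^3"
  assumes S: "connected S" and F: "smooth_on S F" and \<eta>: "smooth_on S \<eta>"
    and inj: "\<And>w. w \<in> S \<Longrightarrow> inj (D F w)"
    and par: "\<And>w. w \<in> S \<Longrightarrow> \<exists>k. \<forall>u. D \<eta> w u = k *\<^sub>R D F w u"
  obtains k c where "\<And>w. w \<in> S \<Longrightarrow> \<eta> w = k *\<^sub>R F w + c"
proof (cases "S = {}")
  case False
  have "open S" using F by (simp add: smooth_on_def)
  have linF: "linear (D F w)" if "w \<in> S" for w
    using has_derivative_linear[OF smooth_on_derivative[OF F that]] .
  \<comment> \<open>an explicit formula for the factor, from which its differentiability can be read off\<close>
  define \<kappa> where "\<kappa> w = (D \<eta> w (axis 1 1) \<bullet> D F w (axis 1 1)) / (D F w (axis 1 1) \<bullet> D F w (axis 1 1))" for w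
  have nz: "D F w (axis 1 1) \<noteq> 0" if "w \<in> S" for w
    using inj[OF that] linear_injective_0[OF linF[OF that]] by (metis axis_eq_0_iff zero_neq_one)
  have \<kappa>: "D \<eta> w u = \<kappa> w *\<^sub>R D F w u" if "w \<in> S" for w u
    using par[OF that] nz[OF that] by (auto simp: \<kappa>_def)
  have \<kappa>': "(\<kappa> has_derivative (\<lambda>u. 0)) (at w)" if w: "w \<in> S" for w
  proof -
    have "\<kappa> differentiable (at w)"
      unfolding \<kappa>_def using nz[OF w]
      by (intro differentiable_divide differentiable_inner differentiableI[OF smooth_on_derivative2[OF F w]]
           differentiableI[OF smooth_on_derivative2[OF \<eta> w]]) auto
    then have d: "(\<kappa> has_derivative D \<kappa> w) (at w)" by (simp flip: frechet_derivative_works)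
    have second: "D (\<lambda>y. D \<eta> y v) w u = \<kappa> w *\<^sub>R D (\<lambda>y. D F y v) w u + D \<kappa> w u *\<^sub>R D F w v" for u v
    proof -
      have "((\<lambda>y. \<kappa> y *\<^sub>R D F y v) has_derivative
          (\<lambda>u. \<kappa> w *\<^sub>R D (\<lambda>y. D F y v) w u + D \<kappa> w u *\<^sub>R D F w v)) (at w)"
        by (intro has_derivative_scaleR d smooth_on_derivative2[OF F w])
      then have "((\<lambda>y. D \<eta> y v) has_derivative
          (\<lambda>u. \<kappa> w *\<^sub>R D (\<lambda>y. D F y v) w u + D \<kappa> w u *\<^sub>R D F w v)) (at w)"
        by (rule has_derivative_transform_within_open[OF _ \<open>open S\<close> w]) (simp add: \<kappa>)
      from frechet_derivative_at[OF this] show ?thesis by (simp add: fun_eq_iff)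
    qed
    have "D \<kappa> w u *\<^sub>R D F w v = D \<kappa> w v *\<^sub>R D F w u" for u v
      using second[of u v] second[of v u] smooth_on_symmetric_derivative2[OF F w, of u v]
        smooth_on_symmetric_derivative2[OF \<eta> w, of u v] by simp
    then have "D F w (D \<kappa> w u *\<^sub>R v) = D F w (D \<kappa> w v *\<^sub>R u)" for u v
      by (simp add: linear_cmul[OF linF[OF w]])
    then have *: "D \<kappa> w u *\<^sub>R v = D \<kappa> w v *\<^sub>R u" for u v
      using inj[OF w] by (simp add: inj_eq)
    have "D \<kappa> w (axis 1 1) = 0" "D \<kappa> w (axis 2 1) = 0"
      using *[of "axis 1 1" "axis 2 1"] by (auto simp: vec_eq_iff forall_2 axis_def)
    moreover have "linear (D \<kappa> w)" using has_derivative_linear[OF d] .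
    ultimately have "D \<kappa> w u = 0" for u
      by (subst vec2_expand[of u]) (simp add: linear_add linear_cmul)
    then have "D \<kappa> w = (\<lambda>u. 0)" by (rule ext)
    with d show ?thesis by simp
  qed
  obtain w0 where "w0 \<in> S" using False by blast
  define k where "k = \<kappa> w0"
  have k: "\<kappa> w = k" if "w \<in> S" for w
    unfolding k_def using has_derivative_zero_unique_connected[OF \<open>open S\<close> S \<kappa>' that \<open>w0 \<in> S\<close>] .
  have "((\<lambda>y. \<eta> y - k *\<^sub>R F y) has_derivative (\<lambda>u. 0)) (at w)" if "w \<in> S" for w
  proof -
    have "((\<lambda>y. \<eta> y - k *\<^sub>R F y) has_derivative (\<lambda>u. D \<eta> w u - k *\<^sub>R D F w u)) (at w)"
      by (intro has_derivative_diff has_derivative_scaleR_right smooth_on_derivative[OF \<eta> that]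
          smooth_on_derivative[OF F that])
    then show ?thesis by (simp add: \<kappa>[OF that] k[OF that])
  qed
  then have "\<eta> w - k *\<^sub>R F w = \<eta> w0 - k *\<^sub>R F w0" if "w \<in> S" for w
    using has_derivative_zero_unique_connected[OF \<open>open S\<close> S _ that \<open>w0 \<in> S\<close>] by blast
  then show thesis by (intro that[of k "\<eta> w0 - k *\<^sub>R F w0"]) (simp add: algebra_simps)
qed (use that in blast)

text \<open>The sign at \<open>w\<close> persists nearby: if \<open>g w = s f w\<close>, then \<open>g + s f\<close> is non-zero at \<open>w\<close> and by
  continuity around it, which excludes the other sign.\<close>

lemma sign_locally_constant:
  fixes f g :: "'a::metric_space \<Rightarrow> 'b::real_normed_vector"
  assumes "isCont f w" "isCont g w" "f w \<noteq> 0" and S: "open S" "w \<in> S"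
    and sgn: "\<And>y. y \<in> S \<Longrightarrow> g y = f y \<or> g y = - f y"
  obtains s :: real and T where "s = 1 \<or> s = -1" "open T" "w \<in> T" "\<And>y. y \<in> T \<Longrightarrow> g y = s *\<^sub>R f y"
proof -
  obtain s :: real where s: "s = 1 \<or> s = -1" and gw: "g w = s *\<^sub>R f w"
    using sgn[OF S(2)] by (metis scaleR_minus1_left scaleR_one)
  have "isCont (\<lambda>y. g y + s *\<^sub>R f y) w"
    using assms by (intro continuous_intros)
  moreover have "g w + s *\<^sub>R f w \<noteq> 0"
    using s assms(3) by (auto simp: gw simp flip: scaleR_2)
  ultimately obtain r where "r > 0" "\<forall>y. dist w y < r \<longrightarrow> g y + s *\<^sub>R f y \<noteq> 0"
    using continuous_at_avoid[of w "\<lambda>y. g y + s *\<^sub>R f y" 0] by blast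
  then obtain T where T: "open T" "w \<in> T" "\<And>y. y \<in> T \<Longrightarrow> g y + s *\<^sub>R f y \<noteq> 0"
    by (metis centre_in_ball mem_ball open_ball)
  have "g y = s *\<^sub>R f y" if "y \<in> S \<inter> T" for y
    using sgn[of y] T(3)[of y] that s by auto
  then show thesis using that[OF s, of "S \<inter> T"] S T by blast
qed

text \<open>Umbilicity at different points may be witnessed by different normal fields \<open>\<eta>'\<close>. Near the
  point in question each agrees with the fixed field \<open>\<eta>\<close> up to a constant sign, which at
  most changes the sign of the eigenvalue.\<close>

lemma umbilic_patch_affine:
  fixes F \<eta> :: "real^2 \<Rightarrow> real^3"
  assumes N: "admissible_norm N" and S: "connected S"
    and F: "smooth_on S F" and inj: "\<And>w. w \<in> S \<Longrightarrow> inj (D F w)" and \<eta>: "smooth_on S \<eta>"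
    and normal: "\<And>y. y \<in> S \<Longrightarrow> N (\<eta> y) = 1" "\<And>y. y \<in> S \<Longrightarrow> birkhoff_orthogonal N (\<eta> y) (range (D F y))"
    and umb: "\<And>w. w \<in> S \<Longrightarrow> \<exists>S' \<eta>' k. w \<in> S' \<and> smooth_on S' \<eta>' \<and>
      (\<forall>y\<in>S'. N (\<eta>' y) = 1 \<and> birkhoff_orthogonal N (\<eta>' y) (range (D F y))) \<and>
      rel_eigenvalues (D \<eta>' w) (D F w) = {k}"
  obtains k c where "\<And>w. w \<in> S \<Longrightarrow> \<eta> w = k *\<^sub>R F w + c"
proof -
  have N': "is_norm N" "strictly_convex_norm N" using N by (auto simp: admissible_norm_def)
  have "open S" using F by (simp add: smooth_on_def)
  have "\<exists>k. \<forall>u. D \<eta> w u = k *\<^sub>R D F w u" if w: "w \<in> S" for w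
  proof -
    obtain S' \<eta>' k where w': "w \<in> S'" and \<eta>': "smooth_on S' \<eta>'"
      and n': "\<And>y. y \<in> S' \<Longrightarrow> N (\<eta>' y) = 1" "\<And>y. y \<in> S' \<Longrightarrow> birkhoff_orthogonal N (\<eta>' y) (range (D F y))"
      and ev: "rel_eigenvalues (D \<eta>' w) (D F w) = {k}"
      using umb[OF w] by blast
    have "open S'" using \<eta>' by (simp add: smooth_on_def)
    have "\<eta>' w \<noteq> 0" using n'(1)[OF w'] N'(1) unfolding is_norm_def by (metis zero_neq_one)
    moreover have "\<eta> y = \<eta>' y \<or> \<eta> y = - \<eta>' y" if "y \<in> S \<inter> S'" for y
      using birkhoff_normal_unique[OF N' n'(2,1) normal(2,1)] that by blast
    ultimately obtain s :: real and T where s: "s = 1 \<or> s = -1" and T: "open T" "w \<in> T"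
      "\<And>y. y \<in> T \<Longrightarrow> \<eta> y = s *\<^sub>R \<eta>' y"
      using sign_locally_constant[of w \<eta>' \<eta> "S \<inter> S'"] w w' \<open>open S\<close> \<open>open S'\<close>
        smooth_on_continuous[OF \<eta> w] smooth_on_continuous[OF \<eta>' w'] by (metis IntI open_Int)
    have "(\<eta> has_derivative (\<lambda>u. s *\<^sub>R D \<eta>' w u)) (at w)"
      by (rule has_derivative_transform_within_open[OF _ T(1,2)])
         (auto intro: has_derivative_scaleR_right smooth_on_derivative[OF \<eta>' w'] simp: T(3))
    then have D: "D \<eta> w = (\<lambda>u. s *\<^sub>R D \<eta>' w u)"
      using frechet_derivative_at by metis
    have "s *\<^sub>R E = x *\<^sub>R L \<longleftrightarrow> E = (s * x) *\<^sub>R L" for E L :: "real^3" and x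
      using s
    proof
      assume s: "s = -1"
      show ?thesis unfolding s by (simp, metis minus_minus)
    qed simp
    then have "x \<in> rel_eigenvalues (D \<eta> w) (D F w) \<longleftrightarrow> s * x \<in> rel_eigenvalues (D \<eta>' w) (D F w)" for x
      unfolding D rel_eigenvalues_def by simp
    moreover have "s * x = k \<longleftrightarrow> x = s * k" for x
      using s by auto
    ultimately have "rel_eigenvalues (D \<eta> w) (D F w) = {s * k}"
      unfolding ev by blast
    then show ?thesis
      using umbilic_imp_proportional[OF N F \<eta> w inj[OF w] normal] by blast
  qed
  then show thesis
    using proportional_imp_affine[OF S F \<eta> inj] that by blast
qed

section \<open>Changing charts\<close>

lemma Ck_on_subset: "Ck_on k f S \<Longrightarrow> T \<subseteq> S \<Longrightarrow> Ck_on k f T"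
  by (induction k arbitrary: f) (auto intro: continuous_on_subset)

lemma smooth_on_subset: "smooth_on S f \<Longrightarrow> open T \<Longrightarrow> T \<subseteq> S \<Longrightarrow> smooth_on T f"
  unfolding smooth_on_def using Ck_on_subset by blast

lemma rel_eigenvalues_compose:
  assumes "linear T" "bij T"
  shows "rel_eigenvalues (E \<circ> T) (L \<circ> T) = rel_eigenvalues E L"
proof -
  have T: "T u = 0 \<longleftrightarrow> u = 0" for u
    using assms by (metis bij_is_inj linear_0 linear_injective_0)
  have "(\<exists>u. u \<noteq> 0 \<and> E (T u) = k *\<^sub>R L (T u)) \<longleftrightarrow> (\<exists>u. u \<noteq> 0 \<and> E u = k *\<^sub>R L u)" for k
    using bij_is_surj[OF assms(2)] T by (metis surj_def)
  then show ?thesis by (simp add: rel_eigenvalues_def)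
qed

lemma chart_at_in_atlas:
  assumes "smooth_atlas M A" "q \<in> topspace M"
  shows "chart_at A q \<in> A" "q \<in> fst (chart_at A q)"
proof -
  obtain c where "c \<in> A \<and> q \<in> fst c"
    using assms unfolding smooth_atlas_def by blast
  then have "chart_at A q \<in> A \<and> q \<in> fst (chart_at A q)"
    unfolding chart_at_def by (rule someI)
  then show "chart_at A q \<in> A" "q \<in> fst (chart_at A q)" by auto
qed

lemma chart_facts:
  assumes "smooth_atlas M A" "c \<in> A"
  shows chart_openin: "openin M (fst c)"
    and chart_inj: "inj_on (snd c) (fst c)"
    and chart_open_image: "\<And>V. openin M V \<Longrightarrow> open (snd c ` (fst c \<inter> V))"
    and chart_openin_vimage: "\<And>B. open B \<Longrightarrow> openin M {q \<in> fst c. snd c q \<in> B}"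
proof -
  let ?U = "fst c" and ?\<phi> = "snd c"
  have U: "openin M ?U" and im: "open (?\<phi> ` ?U)"
    and hom: "homeomorphic_map (subtopology M ?U) (top_of_set (?\<phi> ` ?U)) ?\<phi>"
    using assms by (auto simp: smooth_atlas_def is_chart_def case_prod_beta)
  have top: "topspace (subtopology M ?U) = ?U"
    using openin_subset[OF U] by auto
  show "openin M ?U" by (rule U)
  show "inj_on ?\<phi> ?U"
    using homeomorphic_imp_injective_map[OF hom] by (simp only: top)
  show "open (?\<phi> ` (?U \<inter> V))" if "openin M V" for V
  proof -
    have "openin (subtopology M ?U) (?U \<inter> V)"
      using that by (metis inf_commute openin_subtopology)
    then have "openin (top_of_set (?\<phi> ` ?U)) (?\<phi> ` (?U \<inter> V))"
      using homeomorphic_imp_open_map[OF hom] unfolding open_map_def by blast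
    then show ?thesis using im openin_open_eq by blast
  qed
  show "openin M {q \<in> ?U. ?\<phi> q \<in> B}" if "open B" for B
  proof -
    have "openin (top_of_set (?\<phi> ` ?U)) (?\<phi> ` ?U \<inter> B)"
      using that by (rule openin_open_Int)
    from openin_continuous_map_preimage[OF homeomorphic_imp_continuous_map[OF hom] this]
    have "openin (subtopology M ?U) {q \<in> ?U. ?\<phi> q \<in> ?\<phi> ` ?U \<inter> B}"
      by (simp only: top)
    moreover have "{q \<in> ?U. ?\<phi> q \<in> ?\<phi> ` ?U \<inter> B} = {q \<in> ?U. ?\<phi> q \<in> B}" by blast
    ultimately show ?thesis using openin_trans_full[OF _ U] by simp
  qed
qed

lemma in_chart_apply:
  assumes "smooth_atlas M A" "c \<in> A" "q \<in> fst c"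
  shows "in_chart c g (snd c q) = g q"
  using inv_into_f_f[OF chart_inj[OF assms(1,2)] assms(3)] by (simp add: in_chart_def)

lemma transition_derivative:
  assumes at: "smooth_atlas M A" and c: "c \<in> A" "q \<in> fst c" and d: "d \<in> A" "q \<in> fst d"
    and g: "(in_chart d g has_derivative g') (at (snd d q))"
  shows "(in_chart c g has_derivative g' \<circ> D (in_chart c (snd d)) (snd c q)) (at (snd c q))"
proof -
  let ?\<tau> = "in_chart c (snd d)" and ?S = "snd c ` (fst c \<inter> fst d)"
  have \<tau>: "smooth_on ?S ?\<tau>" and q: "snd c q \<in> ?S"
    using at c d by (auto simp: smooth_atlas_def)
  then have "open ?S" by (simp add: smooth_on_def)
  have "(in_chart d g has_derivative g') (at (?\<tau> (snd c q)))"
    using g by (simp add: in_chart_apply[OF at c])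
  from diff_chain_at[OF smooth_on_derivative[OF \<tau> q] this]
  show ?thesis
  proof (rule has_derivative_transform_within_open[OF _ \<open>open ?S\<close> q])
    show "(in_chart d g \<circ> ?\<tau>) y = in_chart c g y" if "y \<in> ?S" for y
      using that by (auto simp: in_chart_apply[OF at c(1)] in_chart_apply[OF at d(1)])
  qed
qed

text \<open>\<open>differential\<close> refers to a chart picked separately for every point, whereas calculus near a
  point needs one chart for all nearby points. The two differ by precomposition with the
  derivative of the transition map; the reverse transition supplies its inverse. The same
  \<open>T\<close> serves the immersion and all normal fields, so that planes and relative eigenvalues are
  unaffected.\<close>

lemma differential_in_chart:
  assumes at: "smooth_atlas M A" and c: "c \<in> A" "q \<in> fst c"
  obtains T where "linear T" "bij T"
    "\<And>g V. smooth_map_on A V g \<Longrightarrow> q \<in> V \<Longrightarrow>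
       linear (differential A g q) \<and> D (in_chart c g) (snd c q) = differential A g q \<circ> T"
proof -
  let ?d = "chart_at A q"
  have "q \<in> topspace M" using at c unfolding smooth_atlas_def by blast
  note d = chart_at_in_atlas[OF at this]
  define T where "T = D (in_chart c (snd ?d)) (snd c q)"
  define T' where "T' = D (in_chart ?d (snd c)) (snd ?d q)"
  have inverse: "D (in_chart x (snd y)) (snd x q) \<circ> D (in_chart y (snd x)) (snd y q) = id"
    and lin: "linear (D (in_chart x (snd y)) (snd x q))"
    if x: "x \<in> A" "q \<in> fst x" and y: "y \<in> A" "q \<in> fst y" for x y :: "'a chart"
  proof -
    have "smooth_on (snd x ` (fst x \<inter> fst y)) (in_chart x (snd y))" "snd x q \<in> snd x ` (fst x \<inter> fst y)"
      using at x y by (auto simp: smooth_atlas_def)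
    from smooth_on_derivative[OF this]
    have der: "(in_chart x (snd y) has_derivative D (in_chart x (snd y)) (snd x q)) (at (snd x q))" .
    then show "linear (D (in_chart x (snd y)) (snd x q))" by (rule has_derivative_linear)
    have "(in_chart y (snd y) has_derivative
        D (in_chart x (snd y)) (snd x q) \<circ> D (in_chart y (snd x)) (snd y q)) (at (snd y q))"
      by (rule transition_derivative[OF at y x der])
    moreover have "(in_chart y (snd y) has_derivative id) (at (snd y q))"
    proof (rule has_derivative_transform_within_open)
      show "((\<lambda>z. z) has_derivative id) (at (snd y q))" by (simp add: id_def)
      have "openin M (fst y)" by (rule chart_openin[OF at y(1)])
      from chart_open_image[OF at y(1) this] show "open (snd y ` fst y)" by simp
      show "snd y q \<in> snd y ` fst y" using y by blast
      show "z = in_chart y (snd y) z" if "z \<in> snd y ` fst y" for z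
        using that by (auto simp: in_chart_apply[OF at y(1)])
    qed
    ultimately show "D (in_chart x (snd y)) (snd x q) \<circ> D (in_chart y (snd x)) (snd y q) = id"
      by (rule has_derivative_unique)
  qed
  have "T' \<circ> T = id" "T \<circ> T' = id"
    unfolding T_def T'_def by (rule inverse[OF d c] inverse[OF c d])+
  then have "bij T" by (rule o_bij)
  moreover have "linear T" unfolding T_def by (rule lin[OF c d])
  moreover have "linear (differential A g q) \<and> D (in_chart c g) (snd c q) = differential A g q \<circ> T"
    if g: "smooth_map_on A V g" "q \<in> V" for g :: "'a \<Rightarrow> real^3" and V
  proof -
    have "smooth_on (snd ?d ` (fst ?d \<inter> V)) (in_chart ?d g)" "snd ?d q \<in> snd ?d ` (fst ?d \<inter> V)"
      using g d by (auto simp: smooth_map_on_def)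
    from smooth_on_derivative[OF this]
    have der: "(in_chart ?d g has_derivative differential A g q) (at (snd ?d q))"
      by (simp add: differential_def)
    from frechet_derivative_at[OF transition_derivative[OF at c d this]] has_derivative_linear[OF der]
    show ?thesis by (simp add: T_def)
  qed
  ultimately show thesis using that by blast
qed

lemma principal_curvatures_eq_rel_eigenvalues:
  assumes "linear (differential A f q)" "inj (differential A f q)"
  shows "principal_curvatures A f \<eta> q = rel_eigenvalues (differential A \<eta> q) (differential A f q)"
proof -
  have "differential A f q u = 0 \<longleftrightarrow> u = 0" for u
    using assms(2) linear_injective_0[OF assms(1)] linear_0[OF assms(1)] by auto
  then show ?thesis
    by (simp add: principal_curvatures_def rel_eigenvalues_def tangent_plane_def tangent_endo_def
        inv_f_f[OF assms(2)])
qed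

lemma immersion_in_chart:
  assumes at: "smooth_atlas M A" and f: "immersion M A f" and c: "c \<in> A" "q \<in> fst c"
  shows immersion_chart_inj: "inj (D (in_chart c f) (snd c q))"
    and immersion_chart_range: "range (D (in_chart c f) (snd c q)) = tangent_plane A f q"
    and immersion_chart_principal_curvatures: "\<And>V \<eta>. smooth_map_on A V \<eta> \<Longrightarrow> q \<in> V \<Longrightarrow>
       rel_eigenvalues (D (in_chart c \<eta>) (snd c q)) (D (in_chart c f) (snd c q))
         = principal_curvatures A f \<eta> q"
proof -
  have q: "q \<in> topspace M" using at c unfolding smooth_atlas_def by blast
  with f have sm: "smooth_map_on A (topspace M) f" and inj: "inj (differential A f q)"
    by (auto simp: immersion_def)
  obtain T where T: "linear T" "bij T"
    and D: "\<And>g V. smooth_map_on A V g \<Longrightarrow> q \<in> V \<Longrightarrow>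
       linear (differential A g q) \<and> D (in_chart c g) (snd c q) = differential A g q \<circ> T"
    using differential_in_chart[OF at c] by metis
  note Df = D[OF sm q]
  show "inj (D (in_chart c f) (snd c q))"
    unfolding Df[THEN conjunct2] by (rule inj_compose[OF inj bij_is_inj[OF T(2)]])
  show "range (D (in_chart c f) (snd c q)) = tangent_plane A f q"
    unfolding Df[THEN conjunct2] tangent_plane_def image_comp[symmetric] bij_is_surj[OF T(2)] ..
  show "rel_eigenvalues (D (in_chart c \<eta>) (snd c q)) (D (in_chart c f) (snd c q))
         = principal_curvatures A f \<eta> q" if "smooth_map_on A V \<eta>" "q \<in> V" for V \<eta>
    unfolding Df[THEN conjunct2] D[OF that, THEN conjunct2] rel_eigenvalues_compose[OF T]
    by (rule principal_curvatures_eq_rel_eigenvalues[OF Df[THEN conjunct1] inj, symmetric])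
qed

text \<open>All level sets of \<open>\<Phi>\<close> and their complements are open.\<close>

lemma connected_space_locally_constant:
  assumes "connected_space M" and p: "p \<in> topspace M" and q: "q \<in> topspace M"
    and loc: "\<And>x. x \<in> topspace M \<Longrightarrow> \<exists>W. openin M W \<and> x \<in> W \<and> (\<forall>y\<in>W. \<Phi> y = \<Phi> x)"
  shows "\<Phi> q = \<Phi> p"
proof -
  have open_pred: "openin M {x \<in> topspace M. P (\<Phi> x)}" for P
    unfolding openin_subopen[of M "{x \<in> topspace M. P (\<Phi> x)}"]
  proof
    fix x assume x: "x \<in> {x \<in> topspace M. P (\<Phi> x)}"
    then obtain W where W: "openin M W" "x \<in> W" and const: "\<forall>y\<in>W. \<Phi> y = \<Phi> x"
      using loc[of x] by blast
    have "W \<subseteq> {x \<in> topspace M. P (\<Phi> x)}"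
    proof
      fix y assume "y \<in> W"
      with const have "\<Phi> y = \<Phi> x" by blast
      then show "y \<in> {x \<in> topspace M. P (\<Phi> x)}"
        using x openin_subset[OF W(1)] \<open>y \<in> W\<close> by auto
    qed
    with W show "\<exists>T. openin M T \<and> x \<in> T \<and> T \<subseteq> {x \<in> topspace M. P (\<Phi> x)}" by blast
  qed
  let ?T = "{x \<in> topspace M. \<Phi> x = \<Phi> p}"
  have "topspace M - ?T = {x \<in> topspace M. \<Phi> x \<noteq> \<Phi> p}" by blast
  then have "closedin M ?T"
    unfolding closedin_def using open_pred[of "\<lambda>z. z \<noteq> \<Phi> p"] by (intro conjI) (blast, metis)
  moreover have "openin M ?T" by (rule open_pred)
  ultimately have "?T = {} \<or> ?T = topspace M"
    using assms(1)[unfolded connected_space_clopen_in] by meson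
  then show ?thesis using p q by blast
qed

section \<open>The normal as an affine function of the immersion\<close>

text \<open>The pairs \<open>(k, c)\<close> for which \<open>k f + c\<close> is a Birkhoff unit normal of the surface near \<open>p\<close>. As
  this property does not refer to a previously chosen normal field, the set of these pairs can be
  compared at different points of the surface.\<close>

definition affine_normal_at ::
  "(real^3 \<Rightarrow> real) \<Rightarrow> 'a topology \<Rightarrow> 'a chart set \<Rightarrow> ('a \<Rightarrow> real^3) \<Rightarrow> 'a \<Rightarrow> real \<Rightarrow> real^3 \<Rightarrow> bool" where
  "affine_normal_at N M A f p k c \<longleftrightarrow> (\<exists>W. openin M W \<and> p \<in> W \<and>
     (\<forall>q\<in>W. N (k *\<^sub>R f q + c) = 1 \<and> birkhoff_orthogonal N (k *\<^sub>R f q + c) (tangent_plane A f q)))"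

lemma affine_normal_at_minus:
  assumes N: "is_norm N" and "affine_normal_at N M A f p k c"
  shows "affine_normal_at N M A f p (- k) (- c)"
proof -
  have eq: "(- k) *\<^sub>R x + - c = - (k *\<^sub>R x + c)" for x by simp
  have "N (- z) = 1" if "N z = 1" for z
    using N that unfolding is_norm_def by (metis abs_minus_cancel abs_one mult_1 scaleR_minus1_left)
  moreover have "birkhoff_orthogonal N (- z) H" if "birkhoff_orthogonal N z H" for z H
    using birkhoff_orthogonal_minus[OF N, of "- z" H] that by simp
  ultimately show ?thesis
    using assms(2) unfolding affine_normal_at_def eq by meson
qed

text \<open>Near \<open>p\<close> the two normals \<open>k f + c\<close> and \<open>k' f + c'\<close> agree up to a constant sign \<open>s\<close>.
  Differentiating gives \<open>k' = s k\<close>, since \<open>df\<close> is not zero.\<close>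

lemma affine_normal_at_unique:
  assumes N: "is_norm N" "strictly_convex_norm N"
    and at: "smooth_atlas M A" and f: "immersion M A f" and p: "p \<in> topspace M"
    and 1: "affine_normal_at N M A f p k c" and 2: "affine_normal_at N M A f p k' c'"
  shows "(k', c') = (k, c) \<or> (k', c') = (- k, - c)"
proof -
  obtain W where W: "openin M W" "p \<in> W" "\<And>q. q \<in> W \<Longrightarrow> N (k *\<^sub>R f q + c) = 1"
    "\<And>q. q \<in> W \<Longrightarrow> birkhoff_orthogonal N (k *\<^sub>R f q + c) (tangent_plane A f q)"
    using 1 unfolding affine_normal_at_def by blast
  obtain W' where W': "openin M W'" "p \<in> W'" "\<And>q. q \<in> W' \<Longrightarrow> N (k' *\<^sub>R f q + c') = 1"
    "\<And>q. q \<in> W' \<Longrightarrow> birkhoff_orthogonal N (k' *\<^sub>R f q + c') (tangent_plane A f q)"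
    using 2 unfolding affine_normal_at_def by blast
  obtain ch where ch: "ch \<in> A" "p \<in> fst ch"
    using at p unfolding smooth_atlas_def by blast
  let ?F = "in_chart ch f" and ?w = "snd ch p" and ?S = "snd ch ` (fst ch \<inter> (W \<inter> W'))"
  have "smooth_on (snd ch ` (fst ch \<inter> topspace M)) ?F" "?w \<in> snd ch ` (fst ch \<inter> topspace M)"
    using f ch p by (auto simp: immersion_def smooth_map_on_def)
  from smooth_on_derivative[OF this]
  have F: "(?F has_derivative D ?F ?w) (at ?w)" .
  have "open ?S" "?w \<in> ?S"
    using chart_open_image[OF at ch(1) openin_Int[OF W(1) W'(1)]] W(2) W'(2) ch by auto
  moreover have "k' *\<^sub>R ?F y + c' = k *\<^sub>R ?F y + c \<or> k' *\<^sub>R ?F y + c' = - (k *\<^sub>R ?F y + c)" if y: "y \<in> ?S" for y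
  proof -
    obtain q where q: "q \<in> fst ch" "q \<in> W" "q \<in> W'" "y = snd ch q" using y by blast
    then show ?thesis
      using birkhoff_normal_unique[OF N W(4,3) W'(4,3)] by (simp add: in_chart_apply[OF at ch(1)])
  qed
  moreover have "k *\<^sub>R ?F ?w + c \<noteq> 0"
    using W(3)[OF W(2)] N(1) unfolding in_chart_apply[OF at ch] is_norm_def by (metis zero_neq_one)
  moreover have "isCont (\<lambda>y. k *\<^sub>R ?F y + c) ?w" "isCont (\<lambda>y. k' *\<^sub>R ?F y + c') ?w"
    using has_derivative_continuous[OF F] by (auto intro!: continuous_intros)
  ultimately obtain s :: real and T where s: "s = 1 \<or> s = -1" and T: "open T" "?w \<in> T"
      "\<And>y. y \<in> T \<Longrightarrow> k' *\<^sub>R ?F y + c' = s *\<^sub>R (k *\<^sub>R ?F y + c)"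
    using sign_locally_constant[of ?w "\<lambda>y. k *\<^sub>R ?F y + c" "\<lambda>y. k' *\<^sub>R ?F y + c'" ?S] by metis
  have "((\<lambda>y. k' *\<^sub>R ?F y + c') has_derivative (\<lambda>u. k' *\<^sub>R D ?F ?w u)) (at ?w)"
    by (auto intro!: derivative_eq_intros F)
  moreover have "((\<lambda>y. k' *\<^sub>R ?F y + c') has_derivative (\<lambda>u. s *\<^sub>R k *\<^sub>R D ?F ?w u)) (at ?w)"
    by (rule has_derivative_transform_within_open[OF _ T(1,2), of "\<lambda>y. s *\<^sub>R (k *\<^sub>R ?F y + c)"])
       (auto intro!: derivative_eq_intros F simp: T(3))
  ultimately have "(\<lambda>u. k' *\<^sub>R D ?F ?w u) = (\<lambda>u. s *\<^sub>R k *\<^sub>R D ?F ?w u)"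
    by (rule has_derivative_unique)
  then have "k' *\<^sub>R D ?F ?w (axis 1 1) = (s * k) *\<^sub>R D ?F ?w (axis 1 1)"
    by (auto dest: fun_cong)
  moreover have "D ?F ?w (axis 1 1) \<noteq> 0"
    using immersion_chart_inj[OF at f ch] linear_injective_0[OF has_derivative_linear[OF F]]
    by (metis axis_eq_0_iff zero_neq_one)
  ultimately have k: "k' = s * k" by simp
  then have "c' = s *\<^sub>R c" using T(3)[OF T(2)] by (simp add: scaleR_add_right)
  with k s show ?thesis by auto
qed

lemma umbilic_affine_normal_at:
  assumes N: "admissible_norm N" and at: "smooth_atlas M A" and f: "immersion M A f"
    and umb: "\<And>q. q \<in> topspace M \<Longrightarrow> umbilic N M A f q" and p: "p \<in> topspace M"
  obtains k c where "affine_normal_at N M A f p k c"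
proof -
  obtain ch where ch: "ch \<in> A" "p \<in> fst ch"
    using at p unfolding smooth_atlas_def by blast
  have U: "fst ch \<subseteq> topspace M" using at ch unfolding smooth_atlas_def by blast
  let ?in = "in_chart ch" and ?\<phi> = "snd ch"
  note app = in_chart_apply[OF at ch(1)]
  have patch: "smooth_on (?\<phi> ` (fst ch \<inter> V)) (?in \<eta>)"
      "\<And>q. q \<in> fst ch \<inter> V \<Longrightarrow> N (?in \<eta> (?\<phi> q)) = 1 \<and>
         birkhoff_orthogonal N (?in \<eta> (?\<phi> q)) (range (D (?in f) (?\<phi> q)))"
    if "birkhoff_normal_field N M A f V \<eta>" for V \<eta>
    using that ch(1) immersion_chart_range[OF at f ch(1)]
    by (auto simp: birkhoff_normal_field_def smooth_map_on_def unit_sphere_def app)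
  obtain V \<eta> where "p \<in> V" and \<eta>: "birkhoff_normal_field N M A f V \<eta>"
    using umb[OF p] unfolding umbilic_def by blast
  have "open (?\<phi> ` (fst ch \<inter> V))" "?\<phi> p \<in> ?\<phi> ` (fst ch \<inter> V)"
    using patch(1)[OF \<eta>] ch \<open>p \<in> V\<close> by (auto simp: smooth_on_def)
  then obtain r where "r > 0" and r: "ball (?\<phi> p) r \<subseteq> ?\<phi> ` (fst ch \<inter> V)"
    using open_contains_ball by blast
  let ?S = "ball (?\<phi> p) r"
  have F: "smooth_on ?S (?in f)"
    by (rule smooth_on_subset[of "?\<phi> ` (fst ch \<inter> topspace M)"])
       (use f ch r U in \<open>auto simp: immersion_def smooth_map_on_def\<close>)
  have \<eta>S: "smooth_on ?S (?in \<eta>)"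
    by (rule smooth_on_subset[OF patch(1)[OF \<eta>] _ r]) simp
  obtain k c where kc: "\<And>w. w \<in> ?S \<Longrightarrow> ?in \<eta> w = k *\<^sub>R ?in f w + c"
  proof (rule umbilic_patch_affine[OF N connected_ball F _ \<eta>S])
    fix w assume "w \<in> ?S"
    then obtain q where q: "q \<in> fst ch \<inter> V" "w = ?\<phi> q" using r by blast
    show "inj (D (?in f) w)"
      unfolding q(2) by (rule immersion_chart_inj[OF at f ch(1)]) (use q in blast)
    show "N (?in \<eta> w) = 1" "birkhoff_orthogonal N (?in \<eta> w) (range (D (?in f) w))"
      using patch(2)[OF \<eta> q(1)] unfolding q(2) by simp_all
    obtain V' \<eta>' k where V': "q \<in> V'" and \<eta>': "birkhoff_normal_field N M A f V' \<eta>'"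
      and k: "principal_curvatures A f \<eta>' q = {k}"
      using umb[of q] U q(1) unfolding umbilic_def by blast
    have "smooth_map_on A V' \<eta>'" using \<eta>' by (simp add: birkhoff_normal_field_def)
    from immersion_chart_principal_curvatures[OF at f ch(1) _ this V'] q k
    have "rel_eigenvalues (D (?in \<eta>') w) (D (?in f) w) = {k}" by simp
    moreover have "\<forall>y\<in>?\<phi> ` (fst ch \<inter> V'). N (?in \<eta>' y) = 1 \<and>
        birkhoff_orthogonal N (?in \<eta>' y) (range (D (?in f) y))"
      using patch(2)[OF \<eta>'] by blast
    moreover have "w \<in> ?\<phi> ` (fst ch \<inter> V')" using q V' by blast
    ultimately show "\<exists>S' \<eta>' k. w \<in> S' \<and> smooth_on S' \<eta>' \<and>
        (\<forall>y\<in>S'. N (\<eta>' y) = 1 \<and> birkhoff_orthogonal N (\<eta>' y) (range (D (?in f) y))) \<and>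
        rel_eigenvalues (D \<eta>' w) (D (?in f) w) = {k}"
      using patch(1)[OF \<eta>']
      by (intro exI[of _ "?\<phi> ` (fst ch \<inter> V')"] exI[of _ "?in \<eta>'"] exI[of _ k] conjI)
  qed blast
  let ?W = "{q \<in> fst ch. ?\<phi> q \<in> ?S}"
  have "openin M ?W" by (rule chart_openin_vimage[OF at ch(1)]) simp
  moreover have "p \<in> ?W" using ch \<open>r > 0\<close> by simp
  moreover have "N (k *\<^sub>R f q + c) = 1 \<and> birkhoff_orthogonal N (k *\<^sub>R f q + c) (tangent_plane A f q)"
    if "q \<in> ?W" for q
  proof -
    have "q \<in> fst ch" "?\<phi> q \<in> ?\<phi> ` (fst ch \<inter> V)" using that r by auto
    then have q: "q \<in> fst ch \<inter> V"
      using chart_inj[OF at ch(1)] by (auto dest: inj_onD)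
    have "k *\<^sub>R f q + c = ?in \<eta> (?\<phi> q)"
      using kc[of "?\<phi> q"] that by (simp add: app)
    then show ?thesis
      using patch(2)[OF \<eta> q] immersion_chart_range[OF at f ch(1)] q by simp
  qed
  ultimately show thesis using that unfolding affine_normal_at_def by blast
qed

text \<open>The function \<open>a \<bullet> f\<close> has derivative zero in every chart, so it is locally constant.\<close>

lemma constant_tangent_plane_imp_planar:
  assumes at: "smooth_atlas M A" and con: "connected_space M" and f: "immersion M A f"
    and a: "\<And>q v. q \<in> topspace M \<Longrightarrow> v \<in> tangent_plane A f q \<Longrightarrow> a \<bullet> v = 0"
    and p: "p \<in> topspace M" and q: "q \<in> topspace M"
  shows "a \<bullet> f q = a \<bullet> f p"
proof (rule connected_space_locally_constant[OF con p q])
  fix x assume x: "x \<in> topspace M"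
  obtain ch where ch: "ch \<in> A" "x \<in> fst ch"
    using at x unfolding smooth_atlas_def by blast
  have U: "fst ch \<subseteq> topspace M" using at ch unfolding smooth_atlas_def by blast
  let ?F = "in_chart ch f" and ?\<phi> = "snd ch"
  have F: "smooth_on (?\<phi> ` fst ch) ?F"
    using f ch U by (auto simp: immersion_def smooth_map_on_def Int_absorb2)
  then have "open (?\<phi> ` fst ch)" by (simp add: smooth_on_def)
  then obtain r where "r > 0" and r: "ball (?\<phi> x) r \<subseteq> ?\<phi> ` fst ch"
    using ch open_contains_ball by blast
  have "((\<lambda>y. a \<bullet> ?F y) has_derivative (\<lambda>u. 0)) (at w)" if w: "w \<in> ball (?\<phi> x) r" for w
  proof -
    obtain z where z: "z \<in> fst ch" "w = ?\<phi> z" using w r by blast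
    have "D ?F w u \<in> tangent_plane A f z" for u
      using immersion_chart_range[OF at f ch(1) z(1)] z(2) by blast
    then have "(\<lambda>u. a \<bullet> D ?F w u) = (\<lambda>u. 0)" using a z U by blast
    moreover have "((\<lambda>y. a \<bullet> ?F y) has_derivative (\<lambda>u. a \<bullet> D ?F w u)) (at w)"
      using that r by (intro has_derivative_inner_right smooth_on_derivative[OF F]) auto
    ultimately show ?thesis by simp
  qed
  then have const: "a \<bullet> ?F w = a \<bullet> ?F (?\<phi> x)" if "w \<in> ball (?\<phi> x) r" for w
    using has_derivative_zero_unique_connected[of "ball (?\<phi> x) r" "\<lambda>y. a \<bullet> ?F y" w "?\<phi> x"] that \<open>r > 0\<close>
    by auto
  let ?W = "{q \<in> fst ch. ?\<phi> q \<in> ball (?\<phi> x) r}"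
  have "openin M ?W" by (rule chart_openin_vimage[OF at ch(1)]) simp
  moreover have "x \<in> ?W" using ch \<open>r > 0\<close> by simp
  moreover have "a \<bullet> f y = a \<bullet> f x" if "y \<in> ?W" for y
    using const[of "?\<phi> y"] that ch by (simp add: in_chart_apply[OF at ch(1)])
  ultimately show "\<exists>W. openin M W \<and> x \<in> W \<and> (\<forall>y\<in>W. a \<bullet> f y = a \<bullet> f x)" by blast
qed

theorem proposition4p5:
  fixes N :: "real^3 \<Rightarrow> real"
    and M :: "'a topology" and A :: "'a chart set" and f :: "'a \<Rightarrow> real^3"
  assumes "admissible_norm N"
    and "smooth_surface M A" and "connected_space M"
    and "immersion M A f"
    and "\<forall>p\<in>topspace M. umbilic N M A f p"
  shows "(\<exists>a b. a \<noteq> 0 \<and> f ` topspace M \<subseteq> {x. a \<bullet> x = b}) \<or>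
         (\<exists>c \<rho>. \<rho> > 0 \<and> f ` topspace M \<subseteq> minkowski_sphere N c \<rho>)"
proof (cases "topspace M = {}")
  case True
  have "axis 1 1 \<noteq> (0 :: real^3)" by (simp add: axis_eq_0_iff)
  moreover have "f ` topspace M \<subseteq> {x. axis 1 1 \<bullet> x = 0}" using True by simp
  ultimately show ?thesis by blast
next
  case False
  have N: "is_norm N" "strictly_convex_norm N" and at: "smooth_atlas M A"
    using assms(1,2) by (auto simp: admissible_norm_def smooth_surface_def)
  let ?R = "affine_normal_at N M A f"
  let ?\<Phi> = "\<lambda>q. {(k, c). ?R q k c}"
  obtain p where p: "p \<in> topspace M" using False by blast
  \<comment> \<open>the admissible pairs at a point form one class up to sign, which gives a well-defined
    invariant without choosing an orientation\<close>
  have \<Phi>: "?\<Phi> q = {(k, c), (- k, - c)}" if "q \<in> topspace M" "?R q k c" for q k c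
  proof (rule set_eqI, clarify)
    fix k' c'
    have "(k', c') = (k, c) \<or> (k', c') = (- k, - c)" if "?R q k' c'"
      by (rule affine_normal_at_unique[OF N at assms(4) \<open>q \<in> topspace M\<close> \<open>?R q k c\<close> that])
    moreover have "?R q k' c'" if "(k', c') = (k, c)"
      using that \<open>?R q k c\<close> by simp
    moreover have "?R q k' c'" if "(k', c') = (- k, - c)"
      using that affine_normal_at_minus[OF N(1) \<open>?R q k c\<close>] by simp
    ultimately show "(k', c') \<in> ?\<Phi> q \<longleftrightarrow> (k', c') \<in> {(k, c), (- k, - c)}"
      unfolding mem_Collect_eq prod.case insert_iff empty_iff by argo
  qed
  have umb: "\<And>q. q \<in> topspace M \<Longrightarrow> umbilic N M A f q" using assms(5) by blast
  obtain k c where kc: "?R p k c"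
    by (rule umbilic_affine_normal_at[OF assms(1) at assms(4) umb p])
  have R: "?R q k c" if q: "q \<in> topspace M" for q
  proof -
    have "?\<Phi> q = ?\<Phi> p"
    proof (rule connected_space_locally_constant[where \<Phi> = ?\<Phi>, OF assms(3) p q])
      fix x assume x: "x \<in> topspace M"
      obtain k c where R: "?R x k c"
        by (rule umbilic_affine_normal_at[OF assms(1) at assms(4) umb x])
      then obtain W where W: "openin M W" "x \<in> W" "\<And>y. y \<in> W \<Longrightarrow> ?R y k c"
        unfolding affine_normal_at_def by blast
      have "?\<Phi> y = ?\<Phi> x" if y: "y \<in> W" for y
      proof -
        have "y \<in> topspace M" using openin_subset[OF W(1)] y by blast
        from \<Phi>[OF this W(3)[OF y]] \<Phi>[OF x R] show ?thesis by (rule trans[OF _ sym])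
      qed
      with W(1,2) show "\<exists>W. openin M W \<and> x \<in> W \<and> (\<forall>y\<in>W. ?\<Phi> y = ?\<Phi> x)"
        by (intro exI[of _ W] conjI ballI)
    qed
    moreover have "(k, c) \<in> ?\<Phi> p" using kc by simp
    ultimately have "(k, c) \<in> ?\<Phi> q" by (rule ssubst)
    then show ?thesis by simp
  qed
  then have normal: "N (k *\<^sub>R f q + c) = 1" "birkhoff_orthogonal N (k *\<^sub>R f q + c) (tangent_plane A f q)"
    if "q \<in> topspace M" for q
    using that unfolding affine_normal_at_def by blast+
  show ?thesis
  proof (cases "k = 0")
    case True
    \<comment> \<open>the constant \<open>c\<close> is normal to the surface everywhere, and it is normal to
      only one plane\<close>
    obtain a where a: "a \<noteq> 0" "\<And>H. birkhoff_orthogonal N c H \<Longrightarrow> H = {v. a \<bullet> v = 0}"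
    proof (rule birkhoff_orthogonal_unique_plane[OF assms(1)])
      show "N c = 1" using normal(1)[OF p] True by simp
    qed blast
    have plane: "tangent_plane A f q = {v. a \<bullet> v = 0}" if "q \<in> topspace M" for q
      using a(2) normal(2)[OF that] True by simp
    have "a \<bullet> f q = a \<bullet> f p" if "q \<in> topspace M" for q
      by (rule constant_tangent_plane_imp_planar[OF at assms(3,4) _ p that]) (simp add: plane)
    then have "f ` topspace M \<subseteq> {x. a \<bullet> x = a \<bullet> f p}" by blast
    with a(1) show ?thesis by blast
  next
    case False
    \<comment> \<open>solving \<open>N (k f + c) = 1\<close> for \<open>f\<close>: a sphere about
      \<open>- c / k\<close> of radius \<open>1 / |k|\<close>\<close>
    have "f q - (- (1 / k) *\<^sub>R c) = (1 / k) *\<^sub>R (k *\<^sub>R f q + c)" for q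
      using False by (simp add: scaleR_add_right)
    then have "N (f q - (- (1 / k) *\<^sub>R c)) = 1 / \<bar>k\<bar>" if "q \<in> topspace M" for q
      using N(1) normal(1)[OF that] by (simp add: is_norm_def)
    then have "f ` topspace M \<subseteq> minkowski_sphere N (- (1 / k) *\<^sub>R c) (1 / \<bar>k\<bar>)"
      by (auto simp: minkowski_sphere_def)
    moreover have "1 / \<bar>k\<bar> > 0" using False by simp
    ultimately show ?thesis by blast
  qed
qed

end
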